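(* For every integer $k\ge 1$, the coefficients of $q^n$ in the formal power series $$(-1)^{k-1}\left(\frac{1}{(q;q)_\infty}\sum_{-k<n\le k}(-1)^nq^{n(3n-1)/2}-1\right)(q^3,q^9;q^{12})_\infty$$ are zero for all $0\le n<k(3k+1)/2$, and are positive for all $n\ge k(3k+1)/2$.
   Context: Notation: $(a;q)_\infty=\prod_{j\ge 0}(1-aq^j)$ and $(a_1,\ldots,a_m;q)_\infty=\prod_{1\le j\le m}(a_j;q)_\infty$. *)

theory Defs
  imports "HOL-Analysis.Analysis"
begin

(* For formal power series, prodinf is taken in the metric topology of the type fps,
   i.e. partial products converge coefficientwise. *)
definition qpochhammer_inf :: "'a \<Rightarrow> 'a \<Rightarrow> 'a :: {t2_space, comm_ring_1}" where
  "qpochhammer_inf a q = (\<Prod>j. 1 - a * q ^ j)"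

definition qpochhammer_inf_list :: "'a list \<Rightarrow> 'a \<Rightarrow> 'a :: {t2_space, comm_ring_1}" where
  "qpochhammer_inf_list as q = (\<Prod>a\<leftarrow>as. qpochhammer_inf a q)"

(* The infinite products exist for power series a and q without constant term. *)
lemma qpochhammer_inf_fps_LIMSEQ:
  fixes a q :: "real fps"
  assumes a: "fps_nth a 0 = 0" and q: "fps_nth q 0 = 0"
  shows "(\<lambda>n. \<Prod>j\<le>n. 1 - a * q ^ j) \<longlonglongrightarrow> qpochhammer_inf a q"
proof -
  define P where "P = (\<lambda>n. \<Prod>j\<le>n. 1 - a * q ^ j)"
  have low: "fps_nth (q ^ j) i = 0" if "i < j" for i j
    by (rule startsby_zero_power_prefix[OF q, rule_format, OF that])
  have step: "fps_nth (P (Suc n)) i = fps_nth (P n) i" if "i < Suc n" for n i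
  proof -
    have "fps_nth ((P n * a) * q ^ Suc n) i = 0"
      unfolding fps_mult_nth[of _ "q ^ Suc n"]
      by (rule sum.neutral) (use that in \<open>auto simp: low simp del: power_Suc\<close>)
    moreover have "P (Suc n) = P n - (P n * a) * q ^ Suc n"
      unfolding P_def prod.atMost_Suc right_diff_distrib by (simp only: mult_1_right mult.assoc)
    ultimately show ?thesis by simp
  qed
  have stable: "fps_nth (P n) i = fps_nth (P i) i" if "i \<le> n" for n i
    using that by (induction n rule: dec_induct) (auto simp: step)
  define p where "p = Abs_fps (\<lambda>i. fps_nth (P i) i)"
  have lim: "P \<longlonglongrightarrow> p"
    by (rule tendsto_fpsI) (auto simp: p_def eventually_sequentially intro: stable)
  have "fps_nth p 0 = 1"
    using a by (simp add: p_def P_def)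
  then have "p \<noteq> 0" by auto
  have factor: "1 - a * q ^ j \<noteq> 0" for j
  proof
    assume "1 - a * q ^ j = 0"
    then have "fps_nth (1 - a * q ^ j) 0 = 0" by simp
    with a show False by simp
  qed
  have raw: "raw_has_prod (\<lambda>j. 1 - a * q ^ j) 0 p' \<longleftrightarrow> P \<longlonglongrightarrow> p' \<and> p' \<noteq> 0" for p'
    unfolding raw_has_prod_def P_def add_0_right by (rule refl)
  have prod: "(\<lambda>j. 1 - a * q ^ j) has_prod p"
    unfolding has_prod_def raw using lim \<open>p \<noteq> 0\<close> by blast
  have uniq: "p' = p" if "(\<lambda>j. 1 - a * q ^ j) has_prod p'" for p'
  proof -
    from that factor have "P \<longlonglongrightarrow> p'"
      unfolding has_prod_def raw by blast
    then show ?thesis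
      using lim by (rule LIMSEQ_unique)
  qed
  from prod uniq have "(THE p. (\<lambda>j. 1 - a * q ^ j) has_prod p) = p"
    by (rule the_equality)
  then have "qpochhammer_inf a q = p"
    unfolding qpochhammer_inf_def prodinf_def .
  with lim show ?thesis unfolding P_def by (simp only:)
qed

end

(* Put Q = q^3. Since (Q, Q^3; Q^4) = (Q; Q^2) = (Q; Q) / (q^6; q^6), the series in question is the
   product of 1 / (q^6; q^6), whose coefficients are nonnegative with constant term 1, and of
     Y k = (-1)^(k-1) (S k - (q; q)) / ((q; Q) (q^2; Q)),   S k the truncated pentagonal sum.
   By Euler, 1 / ((q; Q) (q^2; Q)) = sum over integers N of q^N c N, where c N is the series
   sum_l Q^l / ((Q; Q)_l (Q; Q)_(l+N)) in Q, satisfying c N + Q^(N+1) c (N+1) = 1 / (Q; Q)^2.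
   This recurrence yields explicit series d k N in Q such that
     d k N + d (k+1) N = Q^(k(k+1)/2) (c (N+k) - c (N-k-1)),
   i.e. sum_N q^N d k N satisfies the same two-term recurrence in k as Y k. Both tend to 0 as k grows
   (for Y by the pentagonal number theorem, here proved by Shanks' finite identity), so they are equal.
   All d k N have nonnegative coefficients, and the three indices N = -k-1, -k, 1-k, one for each
   residue of n modulo 3, give strict positivity from k(3k+1)/2 onwards. *)
theory Submission
  imports Defs
begin

section \<open>Power series with nonnegative coefficients\<close>

definition nonneg_fps :: "real fps \<Rightarrow> bool" where
  "nonneg_fps f \<longleftrightarrow> (\<forall>n. 0 \<le> fps_nth f n)"

lemma nonneg_fps_nth: "nonneg_fps f \<Longrightarrow> 0 \<le> fps_nth f n"
  by (simp add: nonneg_fps_def)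

lemma nonneg_fps_mult: "nonneg_fps f \<Longrightarrow> nonneg_fps g \<Longrightarrow> nonneg_fps (f * g)"
  by (auto simp: nonneg_fps_def fps_mult_nth intro!: sum_nonneg)

lemma nonneg_fps_add: "nonneg_fps f \<Longrightarrow> nonneg_fps g \<Longrightarrow> nonneg_fps (f + g)"
  by (auto simp: nonneg_fps_def)

lemma nonneg_fps_1: "nonneg_fps 1"
  by (simp add: nonneg_fps_def)

lemma nonneg_fps_X_power: "nonneg_fps (fps_X ^ n)"
  by (simp add: nonneg_fps_def fps_X_power_nth)

lemma nonneg_fps_sum: "(\<And>i. i \<in> A \<Longrightarrow> nonneg_fps (f i)) \<Longrightarrow> nonneg_fps (sum f A)"
  by (auto simp: nonneg_fps_def fps_sum_nth intro!: sum_nonneg)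

lemma nonneg_fps_prod: "(\<And>i. i \<in> A \<Longrightarrow> nonneg_fps (f i)) \<Longrightarrow> nonneg_fps (prod f A)"
  by (induction A rule: infinite_finite_induct) (auto simp: nonneg_fps_1 intro!: nonneg_fps_mult)

lemma inverse_one_minus_X_power:
  assumes "m > 0"
  shows "inverse (1 - fps_X ^ m :: real fps) = Abs_fps (\<lambda>n. if m dvd n then 1 else 0)"
proof (rule fps_inverse_unique)
  let ?g = "Abs_fps (\<lambda>n. if m dvd n then 1 else 0) :: real fps"
  show "(1 - fps_X ^ m) * ?g = 1"
  proof (rule fps_ext)
    fix n
    have nth: "fps_nth ((1 - fps_X ^ m) * ?g) n = fps_nth ?g n - (if n < m then 0 else fps_nth ?g (n - m))"
      unfolding left_diff_distrib fps_sub_nth fps_X_power_mult_nth mult_1_left ..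
    show "fps_nth ((1 - fps_X ^ m) * ?g) n = fps_nth 1 n"
    proof (cases "n < m")
      case True
      then have "m dvd n \<longleftrightarrow> n = 0" by (auto dest: dvd_imp_le)
      then show ?thesis using True by (simp add: nth)
    next
      case False
      then have "m dvd n - m \<longleftrightarrow> m dvd n" by (simp add: dvd_minus_self)
      then show ?thesis using False assms by (simp add: nth)
    qed
  qed
qed

lemma one_minus_X_power_inverse: "m > 0 \<Longrightarrow> (1 - fps_X ^ m) * inverse (1 - fps_X ^ m :: real fps) = 1"
  by (simp add: inverse_mult_eq_1')

lemma nonneg_fps_inverse_one_minus: "m > 0 \<Longrightarrow> nonneg_fps (inverse (1 - fps_X ^ m))"
  by (simp add: inverse_one_minus_X_power nonneg_fps_def)

section \<open>Infinite sums of series of growing order\<close>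

definition graded :: "(nat \<Rightarrow> real fps) \<Rightarrow> bool" where
  "graded f \<longleftrightarrow> (\<forall>l n. n < l \<longrightarrow> fps_nth (f l) n = 0)"

text \<open>The infinite sum of \<open>f\<close>, meaningful only for graded \<open>f\<close>: otherwise the
  truncation at \<open>n\<close> drops terms.\<close>

definition gsum :: "(nat \<Rightarrow> real fps) \<Rightarrow> real fps" where
  "gsum f = Abs_fps (\<lambda>n. \<Sum>l\<le>n. fps_nth (f l) n)"

lemma graded_X_power: "(\<And>l. l \<le> p l) \<Longrightarrow> graded (\<lambda>l. fps_X ^ p l * g l)"
  unfolding graded_def fps_X_power_mult_nth by (metis less_le_trans)

lemma graded_Suc: "graded f \<Longrightarrow> graded (\<lambda>l. f (Suc l))"
  by (auto simp: graded_def)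

lemma gsum_nth:
  assumes "graded f" "n \<le> m"
  shows "fps_nth (gsum f) n = (\<Sum>l\<le>m. fps_nth (f l) n)"
proof -
  have "(\<Sum>l\<le>m. fps_nth (f l) n) = (\<Sum>l\<le>n. fps_nth (f l) n)"
    using assms by (intro sum.mono_neutral_right) (auto simp: graded_def)
  then show ?thesis by (simp add: gsum_def)
qed

lemma gsum_add: "gsum (\<lambda>l. f l + g l) = gsum f + gsum g"
  by (simp add: gsum_def fps_eq_iff sum.distrib)

lemma gsum_diff: "gsum (\<lambda>l. f l - g l) = gsum f - gsum g"
  by (simp add: gsum_def fps_eq_iff sum_subtractf)

lemma gsum_uminus: "gsum (\<lambda>l. - f l) = - gsum f"
  by (simp add: gsum_def fps_eq_iff sum_negf)

lemma gsum_mult: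
  assumes "graded f"
  shows "g * gsum f = gsum (\<lambda>l. g * f l)"
proof (rule fps_ext)
  fix n
  have "fps_nth (g * gsum f) n = (\<Sum>i\<le>n. fps_nth g i * (\<Sum>l\<le>n. fps_nth (f l) (n - i)))"
    by (simp add: fps_mult_nth atLeast0AtMost gsum_nth[OF assms, of _ n])
  also have "\<dots> = (\<Sum>l\<le>n. \<Sum>i\<le>n. fps_nth g i * fps_nth (f l) (n - i))"
    unfolding sum_distrib_left by (rule sum.swap)
  also have "\<dots> = fps_nth (gsum (\<lambda>l. g * f l)) n"
    by (simp add: gsum_def fps_mult_nth atLeast0AtMost)
  finally show "fps_nth (g * gsum f) n = fps_nth (gsum (\<lambda>l. g * f l)) n" .
qed

lemma gsum_Suc:
  assumes "graded f"
  shows "gsum f = f 0 + gsum (\<lambda>l. f (Suc l))"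
proof (rule fps_ext)
  fix n
  have "fps_nth (gsum f) n = (\<Sum>l\<le>Suc n. fps_nth (f l) n)"
    by (rule gsum_nth[OF assms]) simp
  also have "\<dots> = fps_nth (f 0 + gsum (\<lambda>l. f (Suc l))) n"
    unfolding sum.atMost_Suc_shift by (simp add: gsum_def)
  finally show "fps_nth (gsum f) n = fps_nth (f 0 + gsum (\<lambda>l. f (Suc l))) n" .
qed

lemma gsum_shift:
  assumes "graded f" "\<And>l. l < M \<Longrightarrow> f l = 0"
  shows "gsum f = gsum (\<lambda>l. f (l + M))"
  using assms
proof (induction M arbitrary: f)
  case (Suc M)
  have "gsum f = gsum (\<lambda>l. f (Suc l))"
    using gsum_Suc[OF Suc.prems(1)] Suc.prems(2)[of 0] by simp
  also have "\<dots> = gsum (\<lambda>l. f (Suc (l + M)))"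
    by (rule Suc.IH[OF graded_Suc[OF Suc.prems(1)]]) (simp add: Suc.prems(2))
  finally show ?case by simp
qed simp

lemma nonneg_fps_gsum: "(\<And>l. nonneg_fps (f l)) \<Longrightarrow> nonneg_fps (gsum f)"
  by (auto simp: nonneg_fps_def gsum_def intro!: sum_nonneg)

section \<open>The diagonal series and their recurrence\<close>

definition parts :: "nat \<Rightarrow> real fps" where
  "parts m = (\<Prod>j<m. inverse (1 - fps_X ^ Suc j))"

lemma parts_0 [simp]: "parts 0 = 1"
  by (simp add: parts_def)

lemma parts_Suc: "parts (Suc m) = parts m * inverse (1 - fps_X ^ Suc m)"
  by (simp add: parts_def)

lemma parts_rec: "parts m = (1 - fps_X ^ Suc m) * parts (Suc m)"
  using one_minus_X_power_inverse[of "Suc m"] unfolding parts_Suc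
  by (simp add: mult.left_commute del: power_Suc)

lemma nonneg_fps_parts: "nonneg_fps (parts m)"
  unfolding parts_def by (intro nonneg_fps_prod nonneg_fps_inverse_one_minus) simp

lemma parts_nth_Suc: "n \<le> m \<Longrightarrow> fps_nth (parts (Suc m)) n = fps_nth (parts m) n"
proof -
  assume n: "n \<le> m"
  have "fps_nth (fps_X ^ Suc m * parts (Suc m)) n = 0"
    using n unfolding fps_X_power_mult_nth by simp
  then show ?thesis
    by (subst (2) parts_rec) (simp only: left_diff_distrib fps_sub_nth mult_1_left diff_0_right)
qed

lemma parts_nth_ge: "n \<le> m \<Longrightarrow> fps_nth (parts m) n = fps_nth (parts n) n"
  by (induction m rule: dec_induct) (auto simp: parts_nth_Suc)

text \<open>The bounds on \<open>j\<close> make \<open>1 - fps_X ^ j\<close> one of the factors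
  inverted in \<open>parts m\<close>; it cancels, and a product of geometric series is left.\<close>

lemma nonneg_fps_one_minus_parts:
  assumes "0 < j" "j \<le> m"
  shows "nonneg_fps ((1 - fps_X ^ j) * parts m)"
proof -
  have j: "j - 1 \<in> {..<m}" using assms by auto
  have "parts m = inverse (1 - fps_X ^ j) * (\<Prod>i\<in>{..<m} - {j - 1}. inverse (1 - fps_X ^ Suc i))"
    unfolding parts_def using prod.remove[OF finite_lessThan j, of "\<lambda>i. inverse (1 - fps_X ^ Suc i) :: real fps"] assms by (simp del: power_Suc)
  then have "(1 - fps_X ^ j) * parts m = (\<Prod>i\<in>{..<m} - {j - 1}. inverse (1 - fps_X ^ Suc i))"
    using one_minus_X_power_inverse[OF assms(1)] by (simp flip: mult.assoc)
  moreover have "nonneg_fps \<dots>"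
    by (intro nonneg_fps_prod nonneg_fps_inverse_one_minus) simp
  ultimately show ?thesis by (simp only:)
qed

lemma parts_pos: "0 < m \<Longrightarrow> 0 < fps_nth (parts m) n"
proof (induction m)
  case (Suc m)
  show ?case
  proof (cases "m = 0")
    case True
    then show ?thesis using inverse_one_minus_X_power[of 1] by (simp add: parts_Suc)
  next
    case False
    have "nonneg_fps (fps_X ^ Suc m * parts (Suc m))"
      by (intro nonneg_fps_mult nonneg_fps_X_power nonneg_fps_parts)
    moreover have "parts (Suc m) = parts m + fps_X ^ Suc m * parts (Suc m)"
      using parts_rec[of m] by (simp add: algebra_simps)
    ultimately show ?thesis
      using Suc.IH False unfolding nonneg_fps_def
      by (metis add_pos_nonneg fps_add_nth not_gr_zero)
  qed
qed simp

text \<open>Up to the section on passing from $q^3$ to $q$, \<^const>\<open>fps_X\<close> stands for $Q = q^3$. The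
  coefficient of $z^N$ in $1/((zq;Q)_\infty(q^2/z;Q)_\infty)$ is \<open>q^N * diagZ N\<close>, and
  \<open>diag\<close> is its restriction to natural \<open>N\<close>.\<close>

definition diag :: "nat \<Rightarrow> real fps" where
  "diag M = gsum (\<lambda>l. fps_X ^ l * (parts (l + M) * parts l))"

definition diagZ :: "int \<Rightarrow> real fps" where
  "diagZ N = gsum (\<lambda>b. if N + int b \<ge> 0 then fps_X ^ b * (parts (nat (N + int b)) * parts b) else 0)"

text \<open>This is 1/(Q;Q)_inf^2: by \<open>parts_nth_ge\<close>, coefficient \<open>n\<close> of
  \<open>parts m\<close> no longer changes once \<open>m\<close> reaches \<open>n\<close>.\<close>

definition diag_limit :: "real fps" where
  "diag_limit = Abs_fps (\<lambda>n. fps_nth (parts n * parts n) n)"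

lemma graded_diag: "graded (\<lambda>l. fps_X ^ l * (parts (l + M) * parts l))"
  by (intro graded_X_power) simp

lemma diagZ_nonneg: "diagZ (int M) = diag M"
  by (simp add: diagZ_def diag_def nat_int_add add.commute flip: of_nat_add)

text \<open>The summands with \<open>b < M\<close> vanish; shifting \<open>b\<close> by
  \<open>M\<close> swaps the roles of the two \<open>parts\<close> factors and releases
  \<open>fps_X ^ M\<close>.\<close>

lemma diagZ_nonpos: "diagZ (- int M) = fps_X ^ M * diag M"
proof -
  define f where "f = (\<lambda>b. if - int M + int b \<ge> 0
    then fps_X ^ b * (parts (nat (- int M + int b)) * parts b) else 0)"
  have gr: "graded f" by (auto simp: graded_def f_def fps_X_power_mult_nth)
  have "diagZ (- int M) = gsum f" by (simp add: diagZ_def f_def)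
  also have "\<dots> = gsum (\<lambda>l. f (l + M))" by (rule gsum_shift[OF gr]) (auto simp: f_def)
  also have "(\<lambda>l. f (l + M)) = (\<lambda>l. fps_X ^ M * (fps_X ^ l * (parts (l + M) * parts l)))"
    by (auto simp: f_def power_add mult_ac)
  finally show ?thesis unfolding diag_def gsum_mult[OF graded_diag] .
qed

text \<open>The summand at \<open>l > 0\<close> is the difference of
  \<open>parts (l + Suc M) * parts l\<close> and its predecessor; both sides are compared over the
  common factors of larger index.\<close>

lemma diag_telescope:
  "(\<Sum>l\<le>n. fps_X ^ l * (parts (l + M) * parts l) + fps_X ^ Suc M * (fps_X ^ l * (parts (l + Suc M) * parts l)))
     = parts (n + Suc M) * parts n"
proof (induction n)
  case 0
  show ?case using parts_rec[of M] by (simp add: left_diff_distrib)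
next
  case (Suc n)
  have 1: "parts (n + Suc M) = (1 - fps_X ^ (n + M + 2)) * parts (n + M + 2)"
    using parts_rec[of "n + Suc M"] by (simp add: numeral_2_eq_2)
  have 2: "parts n = (1 - fps_X ^ Suc n) * parts (Suc n)" by (rule parts_rec)
  have 3: "Suc n + M = n + Suc M" "Suc n + Suc M = n + M + 2" by auto
  show ?case unfolding sum.atMost_Suc Suc.IH 3 1 2
    by (simp add: algebra_simps power_add numeral_2_eq_2)
qed

lemma diag_rec: "diag M + fps_X ^ Suc M * diag (Suc M) = diag_limit"
proof (rule fps_ext)
  fix n
  let ?f = "\<lambda>l. fps_X ^ l * (parts (l + M) * parts l) + fps_X ^ Suc M * (fps_X ^ l * (parts (l + Suc M) * parts l))"
  have "diag M + fps_X ^ Suc M * diag (Suc M) = gsum ?f"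
    unfolding diag_def gsum_mult[OF graded_diag] gsum_add ..
  then have "fps_nth (diag M + fps_X ^ Suc M * diag (Suc M)) n = fps_nth (\<Sum>l\<le>n. ?f l) n"
    by (simp add: gsum_def fps_sum_nth)
  also have "\<dots> = fps_nth (parts (n + Suc M) * parts n) n" by (simp only: diag_telescope)
  also have "\<dots> = fps_nth diag_limit n"
    unfolding diag_limit_def fps_mult_nth fps_nth_Abs_fps
    by (intro sum.cong refl arg_cong2[where f = "(*)"])
       (metis parts_nth_ge atLeastAtMost_iff diff_le_self trans_le_add1)+
  finally show "fps_nth (diag M + fps_X ^ Suc M * diag (Suc M)) n = fps_nth diag_limit n" .
qed

text \<open>This is \<open>diag_rec\<close> for all integers: the power of \<open>fps_X\<close> in
  \<open>diag_rec\<close> is exactly the one that \<open>diagZ\<close> acquires at a negative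
  index.\<close>

lemma diagZ_reflect: "diagZ (- x) + diagZ (x - 1) = diag_limit"
proof (cases "x > 0")
  case True
  then obtain m where m: "x = int (Suc m)" by (metis pos_int_cases gr0_conv_Suc)
  show ?thesis
    using diag_rec[of m] diagZ_nonneg[of m] unfolding m diagZ_nonpos by (simp add: add.commute)
next
  case False
  then have "x \<le> 0" by simp
  then obtain m where m: "x = - int m" by (rule nonpos_int_cases)
  have "x - 1 = - int (Suc m)" "- x = int m" by (simp_all add: m)
  then show ?thesis
    using diag_rec[of m] by (simp only: diagZ_nonpos diagZ_nonneg)
qed

lemma diagZ_minus: "fps_X ^ a * diagZ (int a - int b) = fps_X ^ b * diagZ (int b - int a)"
proof (induction a b rule: linorder_wlog)
  case (le a b)
  then obtain m where b: "b = a + m" using le_Suc_ex by blast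
  show ?case
    using diagZ_nonneg[of m] diagZ_nonpos[of m] by (simp add: b power_add mult_ac)
qed simp

section \<open>Differences of diagonal series\<close>

text \<open>For positive \<open>j\<close> this is \<open>diag j - diag (j - 1)\<close>, by
  \<open>diag_diff\<close>, in a form that shows its nonnegativity.\<close>

definition diag_step :: "nat \<Rightarrow> real fps" where
  "diag_step j = gsum (\<lambda>l. fps_X ^ (2 * l + j) * (parts (l + j) * parts l))"

lemma graded_diag_step: "graded (\<lambda>l. fps_X ^ (2 * l + j) * (parts (l + j) * parts l))"
  by (intro graded_X_power) simp

lemma diag_diff: "diag (Suc j) - diag j = diag_step (Suc j)"
proof -
  have "fps_X ^ l * (parts (l + Suc j) * parts l) - fps_X ^ l * (parts (l + j) * parts l)
      = fps_X ^ (2 * l + Suc j) * (parts (l + Suc j) * parts l)" for l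
    by (subst parts_rec[of "l + j"]) (simp add: algebra_simps power_add mult_2 mult_2_right)
  then show ?thesis by (simp add: diag_def diag_step_def del: add_Suc_right flip: gsum_diff)
qed

text \<open>Summand \<open>l + 1\<close> of \<open>diag M\<close> is matched with summand
  \<open>l\<close> of \<open>fps_X * diag (M + 2)\<close>. Over common factors the numerators differ
  by X^(l+1) (1 - X^(M+1)), and the last factor cancels against \<open>parts (l + M + 2)\<close>,
  whence nonnegativity.\<close>

lemma diag_diff2:
  "diag M - fps_X * diag (M + 2) = parts M +
     gsum (\<lambda>l. fps_X ^ (2 * l + 2) * ((1 - fps_X ^ Suc M) * parts (l + M + 2) * parts (Suc l)))"
proof -
  have eq: "fps_X ^ Suc l * (parts (Suc l + M) * parts (Suc l)) - fps_X * (fps_X ^ l * (parts (l + (M + 2)) * parts l))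
      = fps_X ^ (2 * l + 2) * ((1 - fps_X ^ Suc M) * parts (l + M + 2) * parts (Suc l))" for l
  proof -
    have 1: "parts (Suc l + M) = (1 - fps_X ^ (l + M + 2)) * parts (l + M + 2)"
      using parts_rec[of "Suc l + M"] by (simp add: numeral_2_eq_2)
    have 2: "parts l = (1 - fps_X ^ Suc l) * parts (Suc l)" by (rule parts_rec)
    have 3: "l + (M + 2) = l + M + 2" by simp
    show ?thesis unfolding 1 2 3 by (simp add: algebra_simps power_add mult_2 mult_2_right power2_eq_square)
  qed
  have "diag M = parts M + gsum (\<lambda>l. fps_X ^ Suc l * (parts (Suc l + M) * parts (Suc l)))"
    unfolding diag_def by (subst gsum_Suc[OF graded_diag]) simp
  then show ?thesis
    unfolding diag_def gsum_mult[OF graded_diag] by (simp only: eq gsum_diff[symmetric] add_diff_eq[symmetric])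
qed

lemma nonneg_fps_diag_diff2: "nonneg_fps (diag M - fps_X * diag (M + 2) - parts M)"
proof -
  have *: "nonneg_fps ((1 - fps_X ^ Suc M) * parts (l + M + 2))" for l
    by (rule nonneg_fps_one_minus_parts) auto
  have "nonneg_fps (gsum (\<lambda>l. fps_X ^ (2 * l + 2) * ((1 - fps_X ^ Suc M) * parts (l + M + 2) * parts (Suc l))))"
    by (intro nonneg_fps_gsum nonneg_fps_mult[OF nonneg_fps_X_power nonneg_fps_mult[OF * nonneg_fps_parts]])
  then show ?thesis by (simp only: diag_diff2 add_diff_cancel_left')
qed

lemma diag_diff_telescope:
  "diag M - fps_X ^ m * diag (M + 2 * m) = (\<Sum>i<m. fps_X ^ i * (diag (M + 2 * i) - fps_X * diag (M + 2 * i + 2)))"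
  by (induction m) (simp_all add: algebra_simps)

text \<open>The difference telescopes in index steps of two. The \<open>parts\<close> terms are kept
  as an explicit lower bound, from which strict positivity is drawn later.\<close>

lemma nonneg_fps_diag_diff_sum:
  "nonneg_fps (diag M - fps_X ^ m * diag (M + 2 * m) - (\<Sum>i<m. fps_X ^ i * parts (M + 2 * i)))"
  unfolding diag_diff_telescope sum_subtractf[symmetric] right_diff_distrib[symmetric]
  by (intro nonneg_fps_sum nonneg_fps_mult nonneg_fps_X_power nonneg_fps_diag_diff2)

lemma nonneg_fps_diag_diff: "nonneg_fps (diag M - fps_X ^ m * diag (M + 2 * m))"
proof -
  have "nonneg_fps (\<Sum>i<m. fps_X ^ i * parts (M + 2 * i))"
    by (intro nonneg_fps_sum nonneg_fps_mult nonneg_fps_X_power nonneg_fps_parts)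
  from nonneg_fps_add[OF nonneg_fps_diag_diff_sum[of M m] this] show ?thesis by simp
qed

lemma nonneg_fps_diag_step: "nonneg_fps (diag_step j)"
  unfolding diag_step_def by (intro nonneg_fps_gsum nonneg_fps_mult nonneg_fps_X_power nonneg_fps_parts)

text \<open>The factor 1 - X cancels inside \<open>parts (l + j)\<close>, where \<open>0 < j\<close>
  provides it, and (1 - X^s)/(1 - X) is a geometric sum.\<close>

lemma nonneg_fps_one_minus_diag_step:
  assumes "0 < j"
  shows "nonneg_fps ((1 - fps_X ^ s) * diag_step j)"
proof -
  have *: "nonneg_fps ((1 - fps_X ^ 1) * parts (l + j))" for l
    by (rule nonneg_fps_one_minus_parts) (use assms in auto)
  have "nonneg_fps (gsum (\<lambda>l. fps_X ^ (2 * l + j) * ((1 - fps_X ^ 1) * parts (l + j) * parts l)))"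
    by (intro nonneg_fps_gsum nonneg_fps_mult[OF nonneg_fps_X_power nonneg_fps_mult[OF * nonneg_fps_parts]])
  also have "gsum (\<lambda>l. fps_X ^ (2 * l + j) * ((1 - fps_X ^ 1) * parts (l + j) * parts l)) = (1 - fps_X) * diag_step j"
    unfolding diag_step_def gsum_mult[OF graded_diag_step] by (simp add: mult_ac)
  finally have "nonneg_fps ((\<Sum>i<s. fps_X ^ i) * ((1 - fps_X) * diag_step j))"
    by (rule nonneg_fps_mult[OF nonneg_fps_sum[OF nonneg_fps_X_power]])
  then show ?thesis
    by (simp add: one_diff_power_eq mult_ac)
qed

text \<open>As in \<open>diag_diff2\<close>, summand \<open>l + 1\<close> is matched with summand
  \<open>l\<close>; here the numerators differ by the single power X^(l+1).\<close>

lemma diag_step_diff: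
  "diag_step j - fps_X * diag_step (Suc j) = fps_X ^ j * parts j +
     gsum (\<lambda>l. fps_X ^ (3 * l + j + 3) * (parts (l + Suc j) * parts (Suc l)))"
proof -
  have eq: "fps_X ^ (2 * Suc l + j) * (parts (Suc l + j) * parts (Suc l)) -
      fps_X * (fps_X ^ (2 * l + Suc j) * (parts (l + Suc j) * parts l))
      = fps_X ^ (3 * l + j + 3) * (parts (l + Suc j) * parts (Suc l))" for l
  proof -
    have 2: "parts l = (1 - fps_X ^ Suc l) * parts (Suc l)" by (rule parts_rec)
    have 3: "Suc l + j = l + Suc j" "3 * l + j + 3 = l + l + l + j + 3" by simp_all
    show ?thesis unfolding 2 3 by (simp add: algebra_simps power_add mult_2 mult_2_right eval_nat_numeral)
  qed
  have "diag_step j = fps_X ^ j * parts j + gsum (\<lambda>l. fps_X ^ (2 * Suc l + j) * (parts (Suc l + j) * parts (Suc l)))"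
    unfolding diag_step_def by (subst gsum_Suc[OF graded_diag_step]) simp
  then show ?thesis
    unfolding diag_step_def gsum_mult[OF graded_diag_step] by (simp only: eq gsum_diff[symmetric] add_diff_eq[symmetric])
qed

lemma nonneg_fps_diag_step_diff_parts: "nonneg_fps (diag_step j - fps_X * diag_step (Suc j) - fps_X ^ j * parts j)"
  unfolding diag_step_diff add_diff_cancel_left'
  by (intro nonneg_fps_gsum nonneg_fps_mult nonneg_fps_X_power nonneg_fps_parts)

text \<open>Since X - X^(s+1) = X (1 - X^s), the case of exponent 1 combines with
  \<open>nonneg_fps_one_minus_diag_step\<close>.\<close>

lemma nonneg_fps_diag_step_diff: "nonneg_fps (diag_step j - fps_X ^ Suc s * diag_step (Suc j))"
proof -
  have "nonneg_fps ((diag_step j - fps_X * diag_step (Suc j) - fps_X ^ j * parts j) + fps_X ^ j * parts j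
      + fps_X ^ 1 * ((1 - fps_X ^ s) * diag_step (Suc j)))"
    by (intro nonneg_fps_add nonneg_fps_mult nonneg_fps_X_power nonneg_fps_parts nonneg_fps_diag_step_diff_parts
        nonneg_fps_one_minus_diag_step) simp
  then show ?thesis by (simp add: algebra_simps)
qed

lemma fps_X_power_mult_vanish: "i < m \<Longrightarrow> fps_nth (fps_X ^ m * f) i = (0 :: real)"
  by (simp add: fps_X_power_mult_nth)

lemma Suc_choose_two: "Suc k choose 2 = (k choose 2) + k"
  by (simp add: numeral_2_eq_2)

lemma nonneg_fps_mult_pos1:
  assumes "nonneg_fps f" "nonneg_fps g" "0 < fps_nth f n" "0 < fps_nth g 0"
  shows "0 < fps_nth (f * g) n"
proof -
  have "0 < fps_nth f n * fps_nth g (n - n)" using assms by simp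
  also have "\<dots> \<le> (\<Sum>i=0..n. fps_nth f i * fps_nth g (n - i))"
    by (rule member_le_sum) (use assms in \<open>auto simp: nonneg_fps_def\<close>)
  finally show ?thesis by (simp add: fps_mult_nth)
qed

lemma nonneg_fps_mult_pos2:
  assumes "nonneg_fps f" "nonneg_fps g" "0 < fps_nth f 0" "0 < fps_nth g n"
  shows "0 < fps_nth (f * g) n"
  using nonneg_fps_mult_pos1[of g f n] assms by (simp add: mult.commute)

section \<open>The gap series\<close>

text \<open>At \<open>N = 0\<close> the last factor is the junk value \<open>inverse 0 = 0\<close>; that index is treated
  separately in \<open>gapZ\<close>.\<close>

definition gap :: "nat \<Rightarrow> nat \<Rightarrow> real fps" where
  "gap N k = fps_X ^ ((k choose 2) + N) * (diagZ (int N - int k) - fps_X ^ k * diag (N + k)) * inverse (1 - fps_X ^ N)"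

text \<open>Here and in \<open>gap_le\<close> the bracket becomes a difference to which
  \<open>nonneg_fps_diag_diff\<close> applies, and the power in front displays the order
  \<open>(k choose 2) + max N k\<close>.\<close>

lemma gap_ge:
  "gap (k + m) k = fps_X ^ ((k choose 2) + k + m) * ((diag m - fps_X ^ k * diag (m + 2 * k)) * inverse (1 - fps_X ^ (k + m)))"
proof -
  have 1: "int (k + m) - int k = int m" "k + m + k = m + 2 * k" by simp_all
  show ?thesis unfolding gap_def 1 diagZ_nonneg by (simp add: add.assoc mult.assoc)
qed

lemma gap_le:
  "gap N (N + m) = fps_X ^ (((N + m) choose 2) + N + m) * ((diag m - fps_X ^ N * diag (m + 2 * N)) * inverse (1 - fps_X ^ N))"
proof -
  have 1: "int N - int (N + m) = - int m" "N + (N + m) = m + 2 * N" by simp_all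
  show ?thesis unfolding gap_def 1 diagZ_nonpos by (simp add: power_add right_diff_distrib left_diff_distrib mult_ac)
qed

lemma nonneg_fps_gap: "0 < N \<Longrightarrow> nonneg_fps (gap N k)"
proof (cases "N \<le> k")
  case True
  assume "0 < N"
  then have "nonneg_fps (gap N (N + m))" for m
    unfolding gap_le by (intro nonneg_fps_mult nonneg_fps_X_power nonneg_fps_diag_diff nonneg_fps_inverse_one_minus)
  from this[of "k - N"] show ?thesis using True by simp
next
  case False
  have "nonneg_fps (gap (k + (N - k)) k)"
    unfolding gap_ge by (intro nonneg_fps_mult nonneg_fps_X_power nonneg_fps_diag_diff nonneg_fps_inverse_one_minus)
      (use False in simp)
  then show ?thesis using False by simp
qed

lemma gap_vanish: "i < (k choose 2) + max N k \<Longrightarrow> fps_nth (gap N k) i = 0"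
proof (cases "N \<le> k")
  case True
  assume "i < (k choose 2) + max N k"
  then show ?thesis using True gap_le[of N "k - N"] by (simp add: fps_X_power_mult_vanish)
next
  case False
  assume "i < (k choose 2) + max N k"
  then show ?thesis using False gap_ge[of k "N - k"] by (simp add: fps_X_power_mult_vanish)
qed

text \<open>Reflection and \<open>diag_rec\<close> rewrite the outer two of the four terms through
  \<open>diag_limit\<close>, which then cancels; the rest is divisible by 1 - X^N, and this consumes
  the inverse in \<open>gap\<close>.\<close>

lemma gap_rec:
  assumes "0 < N"
  shows "gap N k + gap N (Suc k) = fps_X ^ (Suc k choose 2) * (diag (N + k) - diagZ (int N - int k - 1))"
proof -
  let ?u = "1 - fps_X ^ N :: real fps" and ?c = "diagZ (int N - int k - 1)"
  have "diagZ (int k - int N) = diag_limit - ?c"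
    using diagZ_reflect[of "int N - int k"] by (simp add: algebra_simps)
  then have 1: "fps_X ^ N * diagZ (int N - int k) = fps_X ^ k * (diag_limit - ?c)"
    using diagZ_minus[of N N] diagZ_minus[of N k] by simp
  have 2: "fps_X ^ Suc (N + k) * diag (Suc (N + k)) = diag_limit - diag (N + k)"
    using diag_rec[of "N + k"] by (simp add: algebra_simps)
  have 3: "int N - int (Suc k) = int N - int k - 1" "N + Suc k = Suc (N + k)" by simp_all
  have "fps_X ^ N * (diagZ (int N - int k) - fps_X ^ k * diag (N + k))
      + fps_X ^ k * (fps_X ^ N * (?c - fps_X ^ Suc k * diag (Suc (N + k))))
    = fps_X ^ N * diagZ (int N - int k) - fps_X ^ (N + k) * diag (N + k)
      + fps_X ^ (N + k) * ?c - fps_X ^ k * (fps_X ^ Suc (N + k) * diag (Suc (N + k)))"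
    by (simp add: algebra_simps power_add)
  also have "\<dots> = fps_X ^ k * (?u * (diag (N + k) - ?c))"
    unfolding 1 2 by (simp add: algebra_simps power_add)
  finally have 4: "fps_X ^ N * (diagZ (int N - int k) - fps_X ^ k * diag (N + k))
      + fps_X ^ k * (fps_X ^ N * (?c - fps_X ^ Suc k * diag (Suc (N + k))))
    = fps_X ^ k * (?u * (diag (N + k) - ?c))" .
  have "gap N k + gap N (Suc k) = fps_X ^ (k choose 2) *
      (fps_X ^ N * (diagZ (int N - int k) - fps_X ^ k * diag (N + k))
      + fps_X ^ k * (fps_X ^ N * (?c - fps_X ^ Suc k * diag (Suc (N + k))))) * inverse ?u"
    unfolding gap_def 3 Suc_choose_two by (simp only: power_add distrib_left distrib_right mult_ac)
  also have "\<dots> = fps_X ^ (Suc k choose 2) * (diag (N + k) - ?c) * (?u * inverse ?u)"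
    unfolding 4 Suc_choose_two by (simp only: power_add mult_ac)
  finally show ?thesis
    by (simp only: one_minus_X_power_inverse[OF assms] mult_1_right)
qed

section \<open>Alternating series and the index zero\<close>

text \<open>Leibniz's estimate. The induction generalises over \<open>a\<close>, since splitting off
  \<open>a 0\<close> leaves the negated sum of the shifted sequence, which lies between 0 and
  \<open>a 1\<close>.\<close>

lemma alternating_sum_bounds:
  fixes a :: "nat \<Rightarrow> real"
  assumes "\<And>i. 0 \<le> a i" "\<And>i. a (Suc i) \<le> a i"
  shows "0 \<le> (\<Sum>i\<le>n. (- 1) ^ i * a i) \<and> (\<Sum>i\<le>n. (- 1) ^ i * a i) \<le> a 0"
  using assms
proof (induction n arbitrary: a)
  case (Suc n)
  from Suc.IH[of "\<lambda>i. a (Suc i)"] Suc.prems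
  have "0 \<le> (\<Sum>i\<le>n. (- 1) ^ i * a (Suc i)) \<and> (\<Sum>i\<le>n. (- 1) ^ i * a (Suc i)) \<le> a 1" by simp
  with Suc.prems(2)[of 0] show ?case
    unfolding sum.atMost_Suc_shift by (simp add: sum_negf)
qed simp

lemma minus_one_power_mult_nth: "fps_nth ((- 1) ^ i * f) n = (- 1) ^ i * fps_nth (f :: real fps) n"
  by (cases "even i") simp_all

lemma nonneg_fps_alternating:
  assumes "\<And>i. nonneg_fps (a i)" "\<And>i. nonneg_fps (a i - a (Suc i))"
  shows "nonneg_fps (gsum (\<lambda>i. (- 1) ^ i * a i))" "nonneg_fps (a 0 - gsum (\<lambda>i. (- 1) ^ i * a i))"
  using alternating_sum_bounds[of "\<lambda>i. fps_nth (a i) n" for n] assms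
  by (simp_all add: nonneg_fps_def gsum_def minus_one_power_mult_nth)

text \<open>The series obtained by unrolling \<open>alt_tail_rec\<close> indefinitely in
  \<open>k\<close>.\<close>

definition alt_tail :: "nat \<Rightarrow> real fps" where
  "alt_tail k = gsum (\<lambda>i. (- 1) ^ i * (fps_X ^ (Suc (k + i) choose 2) * (diag_step (k + i) - diag_step (Suc (k + i)))))"

lemma le_Suc_choose_two: "n \<le> Suc n choose 2"
  by (simp add: Suc_choose_two)

lemma graded_alt_tail: "graded (\<lambda>i. (- 1) ^ i * (fps_X ^ (Suc (k + i) choose 2) * (diag_step (k + i) - diag_step (Suc (k + i)))))"
proof -
  have "i \<le> Suc (k + i) choose 2" for i
    using le_Suc_choose_two[of "k + i"] by simp
  then have "graded (\<lambda>i. fps_X ^ (Suc (k + i) choose 2) * ((- 1) ^ i * (diag_step (k + i) - diag_step (Suc (k + i)))))"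
    by (rule graded_X_power)
  then show ?thesis by (simp only: mult.left_commute)
qed

lemma alt_tail_rec: "alt_tail k + alt_tail (Suc k) = fps_X ^ (Suc k choose 2) * (diag_step k - diag_step (Suc k))"
proof -
  have "alt_tail k = fps_X ^ (Suc k choose 2) * (diag_step k - diag_step (Suc k)) + - alt_tail (Suc k)"
    unfolding alt_tail_def gsum_uminus[symmetric] by (subst gsum_Suc[OF graded_alt_tail]) simp
  then show ?thesis by simp
qed

text \<open>The tail is the difference of two alternating series with decreasing terms
  \<open>a\<close> and \<open>b\<close>. The first is nonnegative and the second is at most its
  leading term \<open>b 0\<close>, which is the summand added here.\<close>

lemma nonneg_fps_alt_tail: "nonneg_fps (alt_tail k + fps_X ^ (Suc k choose 2) * diag_step (Suc k))"
proof -
  define a b where "a = (\<lambda>i. fps_X ^ (Suc (k + i) choose 2) * diag_step (k + i))"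
    and "b = (\<lambda>i. fps_X ^ (Suc (k + i) choose 2) * diag_step (Suc (k + i)))"
  have pos: "nonneg_fps (a i)" "nonneg_fps (b i)" for i
    unfolding a_def b_def by (intro nonneg_fps_mult nonneg_fps_X_power nonneg_fps_diag_step)+
  have "a i - a (Suc i) = fps_X ^ (Suc (k + i) choose 2) * (diag_step (k + i) - fps_X ^ Suc (k + i) * diag_step (Suc (k + i)))"
       "b i - b (Suc i) = fps_X ^ (Suc (k + i) choose 2) * (diag_step (Suc (k + i)) - fps_X ^ Suc (k + i) * diag_step (Suc (Suc (k + i))))" for i
    unfolding a_def b_def Suc_choose_two[of "k + Suc i"]
    by (simp_all add: power_add right_diff_distrib mult_ac)
  then have dec: "nonneg_fps (a i - a (Suc i))" "nonneg_fps (b i - b (Suc i))" for i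
    by (simp_all only: nonneg_fps_mult[OF nonneg_fps_X_power nonneg_fps_diag_step_diff])
  have "alt_tail k = gsum (\<lambda>i. (- 1) ^ i * a i) - gsum (\<lambda>i. (- 1) ^ i * b i)"
    unfolding alt_tail_def gsum_diff[symmetric] a_def b_def by (simp only: right_diff_distrib)
  moreover have "nonneg_fps (gsum (\<lambda>i. (- 1) ^ i * a i) + (b 0 - gsum (\<lambda>i. (- 1) ^ i * b i)))"
    by (intro nonneg_fps_add nonneg_fps_alternating pos dec)
  moreover have "b 0 = fps_X ^ (Suc k choose 2) * diag_step (Suc k)" by (simp add: b_def)
  ultimately show ?thesis by (simp add: diff_add_eq add_diff_eq)
qed

lemma alt_tail_vanish: "i < Suc k choose 2 \<Longrightarrow> fps_nth (alt_tail k) i = 0"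
proof -
  assume i: "i < Suc k choose 2"
  have le: "Suc k choose 2 \<le> Suc (k + l) choose 2" for l
    by (induction l) (simp_all add: Suc_choose_two)
  have "fps_nth (fps_X ^ (Suc (k + l) choose 2) * f) i = 0" for l and f :: "real fps"
    by (rule fps_X_power_mult_vanish[OF less_le_trans[OF i le]])
  then show ?thesis
    by (simp add: alt_tail_def gsum_def minus_one_power_mult_nth)
qed

text \<open>At \<open>N = 0\<close> the recurrence in \<open>k\<close> is solved by an alternating series. Splitting off \<open>gap 1 k\<close>
  leaves second differences of \<open>diag\<close>, whose alternating tail is bounded by its first term.\<close>

definition gapZ :: "nat \<Rightarrow> int \<Rightarrow> real fps" where
  "gapZ k N = (if N = 0 then gap 1 k + alt_tail k else gap (nat \<bar>N\<bar>) k)"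

text \<open>Two instances of \<open>diag_rec\<close> reduce the bracket to (1 - X^(j+1)) times a
  first difference of \<open>diag\<close>; dividing by 1 - X leaves a geometric sum.\<close>

lemma gap_1: "gap 1 (Suc j) = fps_X ^ (Suc j choose 2) * ((\<Sum>i<Suc j. fps_X ^ i) * diag_step (Suc j))"
proof -
  have "fps_X ^ Suc j * (diag j - fps_X * diag (j + 2)) = (1 - fps_X ^ Suc j) * diag_step (Suc j)"
  proof -
    have "fps_X ^ Suc j * (fps_X * diag (j + 2)) = diag_limit - diag (Suc j)"
      using diag_rec[of "Suc j"] by (simp add: algebra_simps)
    moreover have "fps_X ^ Suc j * diag (Suc j) = diag_limit - diag j"
      using diag_rec[of j] by (simp add: algebra_simps)
    ultimately show ?thesis
      unfolding diag_diff[symmetric] right_diff_distrib left_diff_distrib mult_1_left by (simp only:) simp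
  qed
  also have "\<dots> = (1 - fps_X ^ 1) * ((\<Sum>i<Suc j. fps_X ^ i) * diag_step (Suc j))"
    by (simp only: one_diff_power_eq power_one_right mult.assoc)
  finally have eq: "fps_X ^ Suc j * (diag j - fps_X * diag (j + 2)) = (1 - fps_X ^ 1) * ((\<Sum>i<Suc j. fps_X ^ i) * diag_step (Suc j))" .
  have "gap 1 (Suc j) = fps_X ^ (Suc j choose 2) * (fps_X ^ Suc j * (diag j - fps_X * diag (j + 2))) * inverse (1 - fps_X ^ 1)"
    using gap_le[of 1 j] by (simp add: power_add mult_ac)
  also have "\<dots> = fps_X ^ (Suc j choose 2) * ((\<Sum>i<Suc j. fps_X ^ i) * diag_step (Suc j)) * ((1 - fps_X ^ 1) * inverse (1 - fps_X ^ 1))"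
    unfolding eq by (simp only: mult_ac)
  finally show ?thesis by (subst (asm) one_minus_X_power_inverse) simp_all
qed

text \<open>The top term of the geometric sum in \<open>gap_1\<close> is set against the possible
  negative part of \<open>alt_tail\<close>, while the lower terms are nonnegative and
  dropped.\<close>

lemma gapZ_0_ge:
  "nonneg_fps (gapZ (Suc j) 0 - fps_X ^ ((Suc j choose 2) + j) * (diag_step (Suc j) - fps_X * diag_step (Suc (Suc j))))"
proof -
  let ?T = "Suc j choose 2"
  have "nonneg_fps (fps_X ^ ?T * ((\<Sum>i<j. fps_X ^ i) * diag_step (Suc j)))"
    by (intro nonneg_fps_mult nonneg_fps_X_power nonneg_fps_sum nonneg_fps_diag_step)
  from nonneg_fps_add[OF this nonneg_fps_alt_tail[of "Suc j"]] show ?thesis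
    unfolding gapZ_def gap_1 Suc_choose_two[of "Suc j"] by (simp add: algebra_simps power_add)
qed

lemma nonneg_fps_gapZ:
  assumes "0 < k"
  shows "nonneg_fps (gapZ k N)"
proof (cases "N = 0")
  case True
  obtain j where j: "k = Suc j" using assms gr0_conv_Suc by auto
  have "nonneg_fps (fps_X ^ ((Suc j choose 2) + j) * (diag_step (Suc j) - fps_X * diag_step (Suc (Suc j))))"
    using nonneg_fps_mult[OF nonneg_fps_X_power nonneg_fps_diag_step_diff[of "Suc j" 0]] by simp
  from nonneg_fps_add[OF gapZ_0_ge[of j] this] show ?thesis by (simp add: True j)
next
  case False
  then show ?thesis by (simp add: gapZ_def nonneg_fps_gap)
qed

lemma gapZ_vanish:
  assumes "0 < k" "i < (k choose 2) + max (nat \<bar>N\<bar>) k"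
  shows "fps_nth (gapZ k N) i = 0"
proof (cases "N = 0")
  case True
  have "fps_nth (gap 1 k) i = 0" "fps_nth (alt_tail k) i = 0"
    using assms True by (auto intro!: gap_vanish alt_tail_vanish simp: Suc_choose_two)
  then show ?thesis by (simp add: gapZ_def True)
next
  case False
  then show ?thesis using assms by (simp add: gapZ_def gap_vanish)
qed

lemma gapZ_rec:
  assumes "0 < k"
  shows "gapZ k N + gapZ (Suc k) N = fps_X ^ (Suc k choose 2) * (diagZ (N + int k) - diagZ (N - int k - 1))"
proof -
  consider "N = 0" | n where "0 < n" "N = int n" | n where "0 < n" "N = - int n"
    by (metis int_cases2 neq0_conv of_nat_0 minus_zero)
  then show ?thesis
  proof cases
    case 1
    obtain j where j: "k = Suc j" using assms gr0_conv_Suc by auto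
    have a: "diagZ (1 - int k - 1) = diag_limit - diag j"
    proof -
      have "1 - int k - 1 = - int k" "int k - 1 = int j" by (simp_all add: j)
      then show ?thesis using diagZ_reflect[of "int k"] diagZ_nonneg[of j] by (simp add: eq_diff_eq)
    qed
    have b: "diagZ (0 - int k - 1) = diag_limit - diag k"
    proof -
      have "0 - int k - 1 = - (int k + 1)" "int k + 1 - 1 = int k" by simp_all
      then show ?thesis using diagZ_reflect[of "int k + 1"] diagZ_nonneg[of k] by (simp only: eq_diff_eq)
    qed
    have c: "diag_step k = diag k - diag j" "diag_step (Suc k) = diag (Suc k) - diag k"
      by (simp_all add: j diag_diff)
    \<comment> \<open>The right-hand side of \<open>alt_tail_rec\<close> contains minus the second
      difference of \<open>diag\<close> around \<open>k\<close>, exactly what turns the right-hand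
      side for index 1 into that for index 0.\<close>
    have "gapZ k N + gapZ (Suc k) N = (gap 1 k + gap 1 (Suc k)) + (alt_tail k + alt_tail (Suc k))"
      by (simp add: gapZ_def 1)
    also have "\<dots> = fps_X ^ (Suc k choose 2) * (diag k - (diag_limit - diag k))"
      unfolding alt_tail_rec c gap_rec[of 1, simplified of_nat_1, OF zero_less_one] a distrib_left[symmetric]
      by simp
    also have "\<dots> = fps_X ^ (Suc k choose 2) * (diagZ (N + int k) - diagZ (N - int k - 1))"
      using b diagZ_nonneg[of k] by (simp add: 1)
    finally show ?thesis .
  next
    case (2 n)
    then show ?thesis using gap_rec[of n k] diagZ_nonneg[of "n + k"] by (simp add: gapZ_def)
  next
    case (3 n)
    \<comment> \<open>The right-hand side is even in \<open>N\<close>: reflecting both terms swaps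
      them, and the two copies of \<open>diag_limit\<close> cancel.\<close>
    have "diagZ (N + int k) - diagZ (N - int k - 1) = diagZ (int (n + k)) - diagZ (int n - int k - 1)"
    proof -
      have "N + int k = - (int n - int k)" "N - int k - 1 = - (int n + int k + 1)"
           "int (n + k) = int n + int k + 1 - 1" using 3 by simp_all
      then show ?thesis
        using diagZ_reflect[of "int n - int k"] diagZ_reflect[of "int n + int k + 1"]
        by (simp only: eq_diff_eq[symmetric]) simp
    qed
    then show ?thesis using gap_rec[of n k] diagZ_nonneg[of "n + k"] 3 by (simp add: gapZ_def)
  qed
qed

section \<open>Strict positivity of the gap series\<close>

lemma diag_diff_ge_parts:
  assumes "i < m"
  shows "fps_nth (fps_X ^ i * parts (M + 2 * i)) n \<le> fps_nth (diag M - fps_X ^ m * diag (M + 2 * m)) n"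
proof -
  have "fps_nth (fps_X ^ i * parts (M + 2 * i)) n \<le> (\<Sum>i<m. fps_nth (fps_X ^ i * parts (M + 2 * i)) n)"
    by (rule member_le_sum)
      (use assms nonneg_fps_mult[OF nonneg_fps_X_power nonneg_fps_parts] in \<open>auto simp only: nonneg_fps_nth lessThan_iff finite_lessThan\<close>)
  also have "\<dots> \<le> fps_nth (diag M - fps_X ^ m * diag (M + 2 * m)) n"
    using nonneg_fps_nth[OF nonneg_fps_diag_diff_sum[of M m], of n] by (simp only: fps_sub_nth fps_sum_nth diff_ge_0_iff_ge)
  finally show ?thesis .
qed

lemma diag_diff_pos: "0 < M \<Longrightarrow> 0 < m \<Longrightarrow> 0 < fps_nth (diag M - fps_X ^ m * diag (M + 2 * m)) n"
  using diag_diff_ge_parts[of 0 m M n] parts_pos[of M n] by simp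

lemma inverse_one_minus_X_power_nth_0: "0 < m \<Longrightarrow> fps_nth (inverse (1 - fps_X ^ m :: real fps)) 0 = 1"
  by (simp add: inverse_one_minus_X_power)

lemma gap_diag_pos:
  assumes "0 < k"
  shows "0 < fps_nth (gap k k) ((Suc k choose 2) + n)"
proof -
  let ?f = "diag 0 - fps_X ^ k * diag (0 + 2 * k)"
  have 0: "0 < fps_nth ?f 0"
    using diag_diff_ge_parts[of 0 k 0 0] assms by simp
  \<comment> \<open>The summand \<open>i = 0\<close> is now \<open>parts 0 = 1\<close> and secures
    only the constant term. For \<open>k = 1\<close> the geometric series supplies the other
    degrees; for larger \<open>k\<close> the summand \<open>fps_X * parts 2\<close> at
    \<open>i = 1\<close> does.\<close>
  have "0 < fps_nth (?f * inverse (1 - fps_X ^ k)) n"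
  proof (cases "k = 1")
    case True
    have "0 < fps_nth (inverse (1 - fps_X ^ k :: real fps)) n"
      using inverse_one_minus_X_power[of 1] by (simp add: True)
    then show ?thesis
      by (intro nonneg_fps_mult_pos2 nonneg_fps_diag_diff nonneg_fps_inverse_one_minus assms 0)
  next
    case False
    then have "1 < k" using assms by simp
    then have "0 < fps_nth ?f n"
      using diag_diff_ge_parts[of 1 k 0 n] parts_pos[of 2 "n - 1"] 0 by (cases "n = 0") (simp_all add: fps_X_mult_nth numeral_2_eq_2)
    then show ?thesis
      by (intro nonneg_fps_mult_pos1 nonneg_fps_diag_diff nonneg_fps_inverse_one_minus assms)
        (simp_all only: inverse_one_minus_X_power_nth_0 assms zero_less_one)
  qed
  then show ?thesis
    using gap_ge[of k 0] by (simp add: Suc_choose_two fps_X_power_mult_nth)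
qed

lemma gap_above_pos:
  assumes "0 < k"
  shows "0 < fps_nth (gap (Suc k) k) ((Suc k choose 2) + 1 + n)"
proof -
  have "0 < fps_nth ((diag 1 - fps_X ^ k * diag (1 + 2 * k)) * inverse (1 - fps_X ^ (k + 1))) n"
    by (intro nonneg_fps_mult_pos1 nonneg_fps_diag_diff nonneg_fps_inverse_one_minus diag_diff_pos)
      (simp_all only: assms inverse_one_minus_X_power_nth_0 add_gr_0 zero_less_one simp_thms)
  then show ?thesis
    using gap_ge[of k 1] by (simp add: Suc_choose_two fps_X_power_mult_nth del: power_Suc)
qed

lemma gap_below_pos:
  assumes "0 < j"
  shows "0 < fps_nth (gap j (Suc j)) ((Suc (Suc j) choose 2) + n)"
proof -
  have "0 < fps_nth ((diag 1 - fps_X ^ j * diag (1 + 2 * j)) * inverse (1 - fps_X ^ j)) n"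
    by (intro nonneg_fps_mult_pos1 nonneg_fps_diag_diff nonneg_fps_inverse_one_minus diag_diff_pos)
      (simp_all only: assms inverse_one_minus_X_power_nth_0 zero_less_one)
  then show ?thesis
    using gap_le[of j 1] by (simp add: Suc_choose_two[of "Suc j"] fps_X_power_mult_nth del: power_Suc)
qed

text \<open>For \<open>k = 1\<close> the index \<open>1 - k\<close> is 0, out of reach of
  \<open>gap_below_pos\<close>; the term \<open>fps_X ^ 1 * parts 1\<close> below the difference of
  \<open>diag_step\<close> takes over.\<close>

lemma gapZ_1_0_pos: "0 < fps_nth (gapZ 1 0) (1 + n)"
proof -
  have "0 < fps_nth (parts 1) n" by (rule parts_pos) simp
  also have "\<dots> = fps_nth (fps_X ^ 1 * parts 1) (1 + n)" by (simp add: fps_X_mult_nth)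
  also have "\<dots> \<le> fps_nth (diag_step 1 - fps_X * diag_step 2) (1 + n)"
    using nonneg_fps_nth[OF nonneg_fps_diag_step_diff_parts[of 1], of "1 + n"] by (simp add: numeral_2_eq_2)
  also have "\<dots> \<le> fps_nth (gapZ 1 0) (1 + n)"
    using nonneg_fps_nth[OF gapZ_0_ge[of 0], of "1 + n"] by (simp add: numeral_2_eq_2)
  finally show ?thesis .
qed

lemma gapZ_pos:
  assumes "0 < k"
  shows "0 < fps_nth (gapZ k (- int k)) ((Suc k choose 2) + n)"
    and "0 < fps_nth (gapZ k (1 - int k)) ((Suc k choose 2) + n)"
    and "0 < fps_nth (gapZ k (- int k - 1)) ((Suc k choose 2) + 1 + n)"
proof -
  show "0 < fps_nth (gapZ k (- int k)) ((Suc k choose 2) + n)"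
    using assms gap_diag_pos[OF assms, of n] by (simp add: gapZ_def)
  have "nat \<bar>- int k - 1\<bar> = Suc k" by simp
  then show "0 < fps_nth (gapZ k (- int k - 1)) ((Suc k choose 2) + 1 + n)"
    using assms gap_above_pos[OF assms, of n] by (simp add: gapZ_def)
  obtain j where j: "k = Suc j" using assms gr0_conv_Suc by auto
  show "0 < fps_nth (gapZ k (1 - int k)) ((Suc k choose 2) + n)"
  proof (cases "j = 0")
    case True
    then show ?thesis using gapZ_1_0_pos[of n] by (simp add: j numeral_2_eq_2)
  next
    case False
    then show ?thesis using gap_below_pos[of j n] by (simp add: gapZ_def j)
  qed
qed

section \<open>Passing from $q^3$ to $q$\<close>

text \<open>$\sum_{N \in \mathbb{Z}} q^N a_N(q^3)$. Truncating at \<open>i \<le> n\<close> is harmless for interleavable \<open>a\<close>.\<close>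

definition interleave :: "(int \<Rightarrow> real fps) \<Rightarrow> real fps" where
  "interleave a = Abs_fps (\<lambda>n. \<Sum>i\<le>n. fps_nth (a (int n - 3 * int i)) i)"

text \<open>With n = N + 3i the condition reads n < i, so a coefficient of degree \<open>i\<close>
  can contribute only to degrees n at least \<open>i\<close>.\<close>

definition interleavable :: "(int \<Rightarrow> real fps) \<Rightarrow> bool" where
  "interleavable a \<longleftrightarrow> (\<forall>N i. N + 2 * int i < 0 \<longrightarrow> fps_nth (a N) i = 0)"

lemma interleave_nth:
  assumes "interleavable a" "n \<le> m"
  shows "fps_nth (interleave a) n = (\<Sum>i\<le>m. fps_nth (a (int n - 3 * int i)) i)"
proof -
  have "(\<Sum>i\<le>m. fps_nth (a (int n - 3 * int i)) i) = (\<Sum>i\<le>n. fps_nth (a (int n - 3 * int i)) i)"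
    using assms by (intro sum.mono_neutral_right) (auto simp: interleavable_def)
  then show ?thesis by (simp add: interleave_def)
qed

lemma interleave_add: "interleave (\<lambda>N. a N + b N) = interleave a + interleave b"
  by (simp add: interleave_def fps_eq_iff sum.distrib)

lemma interleave_diff: "interleave (\<lambda>N. a N - b N) = interleave a - interleave b"
  by (simp add: interleave_def fps_eq_iff sum_subtractf)

lemma sum_shift_atMost:
  fixes n t :: nat
  shows "(\<Sum>i\<le>n + t. if i < t then 0 else h (i - t)) = (\<Sum>i\<le>n. h i :: real)"
proof (induction t)
  case (Suc t)
  show ?case
    using Suc unfolding add_Suc_right sum.atMost_Suc_shift by (simp cong: if_cong)
qed simp

text \<open>The factor \<open>fps_X ^ t\<close> in Q is q^(3t), and moving the index by
  \<open>s\<close> costs q^s. The bound on \<open>s\<close> keeps the shifted family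
  interleavable.\<close>

lemma interleave_shift:
  assumes a: "interleavable a" and g: "int g = 3 * int t - s" and s: "s \<le> 2 * int t"
  shows "interleave (\<lambda>N. fps_X ^ t * a (N + s)) = fps_X ^ g * interleave a"
proof (rule fps_ext)
  fix n
  let ?b = "\<lambda>N. fps_X ^ t * a (N + s)"
  have "interleavable ?b"
    using a s by (auto simp: interleavable_def fps_X_power_mult_nth of_nat_diff)
  then have "fps_nth (interleave ?b) n = (\<Sum>i\<le>n + t. fps_nth (?b (int n - 3 * int i)) i)"
    by (rule interleave_nth) simp
  also have "\<dots> = (\<Sum>i\<le>n + t. if i < t then 0 else fps_nth (a (int n - int g - 3 * int (i - t))) (i - t))"
    by (intro sum.cong refl) (auto simp: fps_X_power_mult_nth of_nat_diff g algebra_simps)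
  also have "\<dots> = (\<Sum>i\<le>n. fps_nth (a (int n - int g - 3 * int i)) i)"
    by (rule sum_shift_atMost)
  also have "\<dots> = fps_nth (fps_X ^ g * interleave a) n"
  proof (cases "n < g")
    case True
    then show ?thesis
      using a by (simp add: fps_X_power_mult_nth interleavable_def)
  next
    case False
    then show ?thesis
      using interleave_nth[OF a, of "n - g" n] by (simp add: fps_X_power_mult_nth of_nat_diff)
  qed
  finally show "fps_nth (interleave ?b) n = fps_nth (fps_X ^ g * interleave a) n" .
qed

lemma interleavable_diagZ: "interleavable diagZ"
  by (auto simp: interleavable_def diagZ_def gsum_def intro!: sum.neutral)

lemma two_times_Suc_choose_two: "2 * (Suc k choose 2) = k * (k + 1)"
  by (induction k) (simp_all add: Suc_choose_two)

lemma pentagonal_eq: "k * (3 * k + 1) div 2 = 3 * (k choose 2) + 2 * k"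
proof -
  have "k * (3 * k + 1) = 2 * (3 * (k choose 2) + 2 * k)"
    using two_times_Suc_choose_two[of k] by (simp add: Suc_choose_two algebra_simps)
  then show ?thesis by simp
qed

text \<open>The shifts by \<open>k\<close> and by \<open>- k - 1\<close>, each with the factor
  Q^(k(k+1)/2), produce the two pentagonal exponents that enter the truncated sum at step
  \<open>k\<close>.\<close>

lemma interleave_gapZ_rec:
  assumes "0 < k"
  shows "interleave (gapZ k) + interleave (gapZ (Suc k)) =
    (fps_X ^ (k * (3 * k + 1) div 2) - fps_X ^ (k * (3 * k + 1) div 2 + 2 * k + 1)) * interleave diagZ"
proof -
  let ?T = "Suc k choose 2" and ?g = "k * (3 * k + 1) div 2"
  have "interleave (gapZ k) + interleave (gapZ (Suc k)) = interleave (\<lambda>N. fps_X ^ ?T * diagZ (N + int k) - fps_X ^ ?T * diagZ (N + (- int k - 1)))"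
    unfolding interleave_add[symmetric] gapZ_rec[OF assms] by (simp add: right_diff_distrib algebra_simps)
  also have "\<dots> = fps_X ^ ?g * interleave diagZ - fps_X ^ (?g + 2 * k + 1) * interleave diagZ"
    unfolding interleave_diff pentagonal_eq Suc_choose_two
    by (intro arg_cong2[where f = "(-)"] interleave_shift[OF interleavable_diagZ]) auto
  finally show ?thesis by (simp add: left_diff_distrib)
qed

text \<open>A nonzero contribution has i >= C(k,2) + k and |n - 3i| <= i - C(k,2), so n >= 2i +
  C(k,2) >= 3 C(k,2) + 2k.\<close>

lemma interleave_gapZ_vanish:
  assumes "0 < k" "n < k * (3 * k + 1) div 2"
  shows "fps_nth (interleave (gapZ k)) n = 0"
proof -
  have "fps_nth (gapZ k (int n - 3 * int i)) i = 0" for i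
  proof (rule gapZ_vanish[OF assms(1)], rule ccontr)
    assume "\<not> i < (k choose 2) + max (nat \<bar>int n - 3 * int i\<bar>) k"
    then have "(k choose 2) + k \<le> i" "int (k choose 2) + \<bar>int n - 3 * int i\<bar> \<le> int i" by auto
    then show False using assms(2) unfolding pentagonal_eq by linarith
  qed
  then show ?thesis by (simp add: interleave_def)
qed

lemma nonneg_fps_interleave_gapZ: "0 < k \<Longrightarrow> nonneg_fps (interleave (gapZ k))"
  by (auto simp: nonneg_fps_def interleave_def intro!: sum_nonneg nonneg_fps_nth nonneg_fps_gapZ)

text \<open>One positive contribution suffices. At \<open>i = (Suc k choose 2) + u\<close> the
  indices \<open>- k\<close> and \<open>1 - k\<close> reach excess 3u and 3u + 1 over the pentagonal
  number; \<open>- k - 1\<close>, starting one degree later, reaches 3u + 2.\<close>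

lemma interleave_gapZ_pos:
  assumes k: "0 < k" and n: "k * (3 * k + 1) div 2 \<le> n"
  shows "0 < fps_nth (interleave (gapZ k)) n"
proof -
  obtain m where m: "n = 3 * (k choose 2) + 2 * k + m"
    using n unfolding pentagonal_eq using le_Suc_ex by blast
  have pos: "0 < fps_nth (interleave (gapZ k)) n"
    if "0 < fps_nth (gapZ k N) i" "N = int n - 3 * int i" "i \<le> n" for N i
  proof -
    have "0 < fps_nth (gapZ k (int n - 3 * int i)) i" using that by simp
    also have "\<dots> \<le> (\<Sum>i\<le>n. fps_nth (gapZ k (int n - 3 * int i)) i)"
      by (rule member_le_sum) (use that in \<open>auto intro!: nonneg_fps_nth nonneg_fps_gapZ k\<close>)
    finally show ?thesis by (simp add: interleave_def)
  qed
  define u where "u = m div 3"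
  have "m = 3 * u + m mod 3" by (simp add: u_def)
  moreover have "m mod 3 < 3" by simp
  ultimately consider "m = 3 * u" | "m = 3 * u + 1" | "m = 3 * u + 2" by linarith
  then show ?thesis
  proof cases
    case 1
    from gapZ_pos(1)[OF k] show ?thesis by (rule pos[where i = "(Suc k choose 2) + u"]) (auto simp: m 1 Suc_choose_two)
  next
    case 2
    from gapZ_pos(2)[OF k] show ?thesis by (rule pos[where i = "(Suc k choose 2) + u"]) (auto simp: m 2 Suc_choose_two)
  next
    case 3
    from gapZ_pos(3)[OF k] show ?thesis by (rule pos[where i = "(Suc k choose 2) + 1 + u"]) (auto simp: m 3 Suc_choose_two)
  qed
qed

section \<open>Infinite products\<close>

text \<open>Convergence means that each coefficient is eventually constant, and a coefficient of a
  product involves finitely many coefficients of the factors.\<close>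

lemma tendsto_mult_fps:
  fixes f g :: "'a \<Rightarrow> real fps"
  assumes "(f \<longlongrightarrow> a) F" "(g \<longlongrightarrow> b) F"
  shows "((\<lambda>x. f x * g x) \<longlongrightarrow> a * b) F"
proof (rule tendsto_fpsI)
  fix n
  have "\<forall>\<^sub>F x in F. \<forall>i\<in>{..n}. fps_nth (f x) i = fps_nth a i"
    using assms(1) by (subst eventually_ball_finite_distrib) (auto simp: tendsto_fps_iff)
  moreover have "\<forall>\<^sub>F x in F. \<forall>i\<in>{..n}. fps_nth (g x) i = fps_nth b i"
    using assms(2) by (subst eventually_ball_finite_distrib) (auto simp: tendsto_fps_iff)
  ultimately show "\<forall>\<^sub>F x in F. fps_nth (f x * g x) n = fps_nth (a * b) n"
    by eventually_elim (auto simp: fps_mult_nth intro!: sum.cong)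
qed

lemma tendsto_prod_fps_finite:
  fixes f :: "'i \<Rightarrow> 'a \<Rightarrow> real fps"
  assumes "\<And>i. i \<in> I \<Longrightarrow> (f i \<longlongrightarrow> a i) F"
  shows "((\<lambda>x. \<Prod>i\<in>I. f i x) \<longlongrightarrow> (\<Prod>i\<in>I. a i)) F"
  using assms
  by (induction I rule: infinite_finite_induct) (auto intro!: tendsto_mult_fps)

lemma qpochhammer_inf_fps_LIMSEQ_lessThan:
  fixes a q :: "real fps"
  assumes "fps_nth a 0 = 0" "fps_nth q 0 = 0"
  shows "(\<lambda>n. \<Prod>j<n. 1 - a * q ^ j) \<longlonglongrightarrow> qpochhammer_inf a q"
  using qpochhammer_inf_fps_LIMSEQ[OF assms]
  by (simp add: LIMSEQ_lessThan_iff_atMost)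

text \<open>Factors are grouped by exponent modulo \<open>m\<close>. The grouping is exact for
  partial products of length \<open>n * m\<close>, and this subsequence has the same limit.\<close>

lemma qpochhammer_inf_split:
  fixes a q :: "real fps"
  assumes a: "fps_nth a 0 = 0" and q: "fps_nth q 0 = 0" and m: "0 < m"
  shows "qpochhammer_inf a q = (\<Prod>i<m. qpochhammer_inf (a * q ^ i) (q ^ m))"
proof -
  have qm: "fps_nth (q ^ m) 0 = 0" using q m by (simp add: fps_nth_power_0)
  have eq: "(\<Prod>j<n * m. 1 - a * q ^ j) = (\<Prod>i<m. \<Prod>j<n. 1 - a * q ^ i * (q ^ m) ^ j)" for n
  proof -
    have "(\<Prod>j<n * m. 1 - a * q ^ j) = (\<Prod>j<n. \<Prod>i\<in>{j * m..<j * m + m}. 1 - a * q ^ i)"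
      by (rule prod.nat_group[symmetric])
    also have "\<dots> = (\<Prod>j<n. \<Prod>i<m. 1 - a * q ^ i * (q ^ m) ^ j)"
    proof (rule prod.cong[OF refl])
      fix j
      have "(\<Prod>i\<in>{j * m..<j * m + m}. 1 - a * q ^ i) = (\<Prod>i<m. 1 - a * q ^ (i + j * m))"
        using prod.shift_bounds_nat_ivl[of "\<lambda>i. 1 - a * q ^ i" 0 "j * m" m] by (simp add: atLeast0LessThan add.commute)
      then show "(\<Prod>i\<in>{j * m..<j * m + m}. 1 - a * q ^ i) = (\<Prod>i<m. 1 - a * q ^ i * (q ^ m) ^ j)"
        by (simp add: power_add power_mult mult.commute[of j] mult.assoc)
    qed
    also have "\<dots> = (\<Prod>i<m. \<Prod>j<n. 1 - a * q ^ i * (q ^ m) ^ j)" by (rule prod.swap)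
    finally show ?thesis .
  qed
  have "strict_mono (\<lambda>n. n * m)" using m by (simp add: strict_mono_def)
  from LIMSEQ_subseq_LIMSEQ[OF qpochhammer_inf_fps_LIMSEQ_lessThan[OF a q] this]
  have "(\<lambda>n. \<Prod>j<n * m. 1 - a * q ^ j) \<longlonglongrightarrow> qpochhammer_inf a q" by (simp add: o_def)
  moreover have "(\<lambda>n. \<Prod>j<n * m. 1 - a * q ^ j) \<longlonglongrightarrow> (\<Prod>i<m. qpochhammer_inf (a * q ^ i) (q ^ m))"
    unfolding eq by (intro tendsto_prod_fps_finite qpochhammer_inf_fps_LIMSEQ_lessThan qm) (simp add: a)
  ultimately show ?thesis by (rule LIMSEQ_unique)
qed

lemma qpochhammer_inf_nth_0:
  fixes a q :: "real fps"
  assumes a: "fps_nth a 0 = 0" and q: "fps_nth q 0 = 0"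
  shows "fps_nth (qpochhammer_inf a q) 0 = 1"
proof -
  have "fps_nth (\<Prod>j<n. 1 - a * q ^ j) 0 = 1" for n
    by (induction n) (simp_all add: a)
  then show ?thesis
    using qpochhammer_inf_fps_LIMSEQ_lessThan[OF assms] unfolding tendsto_fps_iff
    by (auto dest: spec[of _ 0])
qed

lemma nonneg_fps_inverse_qpochhammer_inf:
  assumes "0 < m"
  shows "nonneg_fps (inverse (qpochhammer_inf (fps_X ^ m) (fps_X ^ m)))"
proof -
  let ?Q = "qpochhammer_inf (fps_X ^ m) (fps_X ^ m) :: real fps" and ?P = "\<lambda>n. \<Prod>j<n. 1 - fps_X ^ m * (fps_X ^ m) ^ j :: real fps"
  have "inverse (?P n) = (\<Prod>j<n. inverse (1 - fps_X ^ (m * Suc j)))" for n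
    by (induction n) (simp_all add: fps_inverse_mult power_mult power_add)
  moreover have "nonneg_fps (\<Prod>j<n. inverse (1 - fps_X ^ (m * Suc j)))" for n
    by (intro nonneg_fps_prod nonneg_fps_inverse_one_minus) (use assms in simp)
  ultimately have nn: "nonneg_fps (inverse (?P n))" for n by simp
  have 0: "fps_nth (fps_X ^ m :: real fps) 0 = 0" using assms by simp
  have "(\<lambda>n. inverse (?P n)) \<longlonglongrightarrow> inverse ?Q"
    by (intro tendsto_inverse_fps qpochhammer_inf_fps_LIMSEQ_lessThan 0) (simp add: qpochhammer_inf_nth_0[OF 0 0])
  then have lim: "\<forall>\<^sub>F n in sequentially. fps_nth (inverse (?P n)) i = fps_nth (inverse ?Q) i" for i
    by (simp add: tendsto_fps_iff)
  show ?thesis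
    unfolding nonneg_fps_def
  proof (intro allI)
    fix i
    obtain n where "fps_nth (inverse (?P n)) i = fps_nth (inverse ?Q) i"
      using eventually_happens'[OF sequentially_bot lim] by blast
    then show "0 \<le> fps_nth (inverse ?Q) i"
      using nonneg_fps_nth[OF nn, of n i] by simp
  qed
qed

lemma fps_nth_compose_X_power:
  assumes "0 < m"
  shows "fps_nth (f oo fps_X ^ m) n = (if m dvd n then fps_nth f (n div m) else (0 :: real))"
proof -
  have "fps_nth (f oo fps_X ^ m) n = (\<Sum>i=0..n. if n = m * i then fps_nth f i else 0)"
    by (simp add: fps_compose_nth fps_X_power_nth if_distrib flip: power_mult cong: if_cong)
  also have "\<dots> = (if m dvd n then fps_nth f (n div m) else 0)"
  proof (cases "m dvd n")
    case True
    then obtain c where c: "n = m * c" by blast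
    have "c \<le> n" using assms by (simp add: c)
    have "(\<Sum>i=0..n. if n = m * i then fps_nth f i else 0) = (\<Sum>i=0..n. if i = c then fps_nth f i else 0)"
      using assms by (intro sum.cong) (auto simp: c)
    also have "\<dots> = fps_nth f c" using \<open>c \<le> n\<close> by simp
    finally show ?thesis using assms by (simp add: c)
  next
    case False
    then have "n \<noteq> m * i" for i by auto
    then show ?thesis using False by simp
  qed
  finally show ?thesis .
qed

section \<open>Euler's expansion of the reciprocal product\<close>

text \<open>Euler's series sum_m z^m/(q^3;q^3)_m at z = q^a, equal to 1/(q^a;q^3)_inf for positive
  \<open>a\<close>.\<close>

definition euler_sum :: "nat \<Rightarrow> real fps" where
  "euler_sum a = gsum (\<lambda>m. fps_X ^ (a * m) * (parts m oo fps_X ^ 3))"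

lemma graded_euler_sum: "0 < a \<Longrightarrow> graded (\<lambda>m. fps_X ^ (a * m) * (parts m oo fps_X ^ 3))"
  by (intro graded_X_power) simp

lemma parts_compose_rec: "parts m oo fps_X ^ 3 = (1 - fps_X ^ (3 * Suc m)) * (parts (Suc m) oo fps_X ^ 3)"
proof -
  have 0: "fps_nth (fps_X ^ 3 :: real fps) 0 = 0" by simp
  have "parts m oo fps_X ^ 3 = ((1 - fps_X ^ Suc m) oo fps_X ^ 3) * (parts (Suc m) oo fps_X ^ 3)"
    unfolding fps_compose_mult_distrib[OF 0, symmetric] parts_rec[of m, symmetric] ..
  also have "(1 - fps_X ^ Suc m) oo fps_X ^ 3 = (1 - (fps_X ^ Suc m oo fps_X ^ 3) :: real fps)"
    by (simp only: fps_compose_sub_distrib fps_compose_1)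
  also have "fps_X ^ Suc m oo fps_X ^ 3 = (fps_X ^ (3 * Suc m) :: real fps)"
    unfolding fps_compose_power[OF 0, symmetric] fps_X_fps_compose_startby0[OF 0] power_mult ..
  finally show ?thesis .
qed

text \<open>Subtracting the series at \<open>a + 3\<close> multiplies summand m by 1 - q^(3m), which
  cancels the last factor of its denominator; shifting m then gives q^a times the series.\<close>

lemma euler_sum_rec:
  assumes "0 < a"
  shows "(1 - fps_X ^ a) * euler_sum a = euler_sum (a + 3)"
proof -
  define f where "f = (\<lambda>m. fps_X ^ (a * m) * (parts m oo fps_X ^ 3) - fps_X ^ ((a + 3) * m) * (parts m oo fps_X ^ 3))"
  have "graded f" using graded_euler_sum[OF assms] graded_euler_sum[of "a + 3"] by (simp add: graded_def f_def)
  moreover have "f 0 = 0" by (simp add: f_def)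
  moreover have "f (Suc m) = fps_X ^ a * (fps_X ^ (a * m) * (parts m oo fps_X ^ 3))" for m
  proof -
    have "(a + 3) * Suc m = a * Suc m + 3 * Suc m" "a * Suc m = a + a * m" by (simp_all only: distrib_right mult_Suc_right)
    then show ?thesis
      unfolding f_def parts_compose_rec[of m] power_add[symmetric] by (simp add: power_add algebra_simps)
  qed
  ultimately have "gsum f = fps_X ^ a * euler_sum a"
    unfolding euler_sum_def gsum_mult[OF graded_euler_sum[OF assms]] by (subst gsum_Suc) simp_all
  moreover have "gsum f = euler_sum a - euler_sum (a + 3)"
    unfolding euler_sum_def f_def by (rule gsum_diff)
  ultimately show ?thesis by (simp add: algebra_simps)
qed

lemma euler_sum_prod: "0 < a \<Longrightarrow> (\<Prod>j<n. 1 - fps_X ^ a * (fps_X ^ 3) ^ j) * euler_sum a = euler_sum (a + 3 * n)"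
proof (induction n)
  case (Suc n)
  have "(\<Prod>j<Suc n. 1 - fps_X ^ a * (fps_X ^ 3) ^ j) * euler_sum a = (1 - fps_X ^ (a + 3 * n)) * euler_sum (a + 3 * n)"
    unfolding Suc.IH[OF Suc.prems, symmetric] by (simp add: power_add mult_ac flip: power_mult)
  also have "\<dots> = euler_sum (a + 3 * Suc n)" using Suc.prems by (subst euler_sum_rec) (simp_all add: add_ac)
  finally show ?case .
qed simp

lemma euler_sum_nth: "i < a \<Longrightarrow> fps_nth (euler_sum a) i = fps_nth 1 i"
proof -
  assume i: "i < a"
  have "fps_nth (fps_X ^ (a * m) * (parts m oo fps_X ^ 3)) i = (if m = 0 then fps_nth 1 i else 0)" for m
  proof (cases m)
    case (Suc m')
    then have "i < a * m" using i by (simp add: trans_less_add1)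
    then show ?thesis using Suc by (simp only: fps_X_power_mult_vanish) simp
  qed simp
  then show ?thesis by (simp add: euler_sum_def gsum_def)
qed

text \<open>Partial products turn \<open>euler_sum a\<close> into
  \<open>euler_sum (a + 3 * n)\<close>, which tends to 1.\<close>

lemma qpochhammer_inf_mult_euler_sum:
  assumes "0 < a"
  shows "qpochhammer_inf (fps_X ^ a) (fps_X ^ 3) * euler_sum a = 1"
proof -
  have "(\<lambda>n. (\<Prod>j<n. 1 - fps_X ^ a * (fps_X ^ 3) ^ j) * euler_sum a) \<longlonglongrightarrow> qpochhammer_inf (fps_X ^ a) (fps_X ^ 3) * euler_sum a"
    by (intro tendsto_mult_fps qpochhammer_inf_fps_LIMSEQ_lessThan tendsto_const) (use assms in simp_all)
  moreover have "(\<lambda>n. (\<Prod>j<n. 1 - fps_X ^ a * (fps_X ^ 3) ^ j) * euler_sum a) \<longlonglongrightarrow> 1"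
    unfolding euler_sum_prod[OF assms]
  proof (rule tendsto_fpsI)
    fix i
    show "\<forall>\<^sub>F n in sequentially. fps_nth (euler_sum (a + 3 * n)) i = fps_nth 1 i"
      using eventually_gt_at_top[of i] by eventually_elim (rule euler_sum_nth, simp)
  qed
  ultimately show ?thesis by (rule LIMSEQ_unique)
qed

text \<open>Coefficient n of the product collects the triples with n = a + 2b + 3j. They are
  regrouped by N = a - b and i = b + j, so that n = N + 3i.\<close>

lemma interleave_diagZ: "interleave diagZ = euler_sum 1 * euler_sum 2"
proof (rule fps_ext)
  fix n
  let ?f = "\<lambda>a m. fps_X ^ (a * m) * (parts m oo fps_X ^ 3)"
  let ?c = "\<lambda>a b i. fps_nth (parts a * parts b) i"
  have f: "fps_nth (?f 1 a * ?f 2 b) n = (if a + 2 * b \<le> n \<and> 3 dvd n - (a + 2 * b) then ?c a b ((n - (a + 2 * b)) div 3) else 0)" for a b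
  proof -
    have "?f 1 a * ?f 2 b = fps_X ^ (a + 2 * b) * ((parts a * parts b) oo fps_X ^ 3)"
      by (simp add: fps_compose_mult_distrib power_add mult_ac)
    then show ?thesis by (simp add: fps_X_power_mult_nth fps_nth_compose_X_power)
  qed
  have eul1: "euler_sum 1 * ?f 2 b = gsum (\<lambda>a. ?f 2 b * ?f 1 a)" for b
    by (subst mult.commute) (simp only: euler_sum_def gsum_mult[OF graded_euler_sum[OF zero_less_one]])
  have "fps_nth (euler_sum 1 * euler_sum 2) n = (\<Sum>b\<le>n. fps_nth (euler_sum 1 * ?f 2 b) n)"
    unfolding euler_sum_def[of 2] gsum_mult[OF graded_euler_sum[OF zero_less_numeral]] by (simp add: gsum_def)
  also have "\<dots> = (\<Sum>b\<le>n. fps_nth (gsum (\<lambda>a. ?f 2 b * ?f 1 a)) n)"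
    by (simp only: eul1)
  also have "\<dots> = (\<Sum>b\<le>n. \<Sum>a\<le>n. fps_nth (?f 1 a * ?f 2 b) n)"
    by (simp add: gsum_def mult.commute)
  also have "\<dots> = (\<Sum>b\<le>n. \<Sum>a\<in>{a\<in>{..n}. a + 2 * b \<le> n \<and> 3 dvd n - (a + 2 * b)}. ?c a b ((n - (a + 2 * b)) div 3))"
    unfolding f by (simp only: sum.inter_filter finite_atMost)
  also have "\<dots> = (\<Sum>b\<le>n. \<Sum>i\<in>{i\<in>{..n}. b \<le> i \<and> 3 * i \<le> n + b}. ?c (n + b - 3 * i) b (i - b))"
  proof (rule sum.cong[OF refl])
    fix b
    show "(\<Sum>a\<in>{a\<in>{..n}. a + 2 * b \<le> n \<and> 3 dvd n - (a + 2 * b)}. ?c a b ((n - (a + 2 * b)) div 3))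
        = (\<Sum>i\<in>{i\<in>{..n}. b \<le> i \<and> 3 * i \<le> n + b}. ?c (n + b - 3 * i) b (i - b))"
    \<comment> \<open>For fixed \<open>b\<close> the two maps are i = b + j with j = (n - a - 2b)/3,
      and its inverse a = n + b - 3i.\<close>
    proof (rule sum.reindex_bij_witness[of _ "\<lambda>i. n + b - 3 * i" "\<lambda>a. b + (n - (a + 2 * b)) div 3"])
      fix i assume "i \<in> {i\<in>{..n}. b \<le> i \<and> 3 * i \<le> n + b}"
      then have i: "i \<le> n" "b \<le> i" "3 * i \<le> n + b" by auto
      then have "n - (n + b - 3 * i + 2 * b) = 3 * (i - b)" by auto
      then show "b + (n - (n + b - 3 * i + 2 * b)) div 3 = i"
        "n + b - 3 * i \<in> {a\<in>{..n}. a + 2 * b \<le> n \<and> 3 dvd n - (a + 2 * b)}"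
        using i by auto
    next
      fix a assume "a \<in> {a\<in>{..n}. a + 2 * b \<le> n \<and> 3 dvd n - (a + 2 * b)}"
      then obtain j where "a + 2 * b \<le> n" "n - (a + 2 * b) = 3 * j" by (auto elim: dvdE)
      then have j: "n = a + 2 * b + 3 * j" by simp
      show "n + b - 3 * (b + (n - (a + 2 * b)) div 3) = a"
        "b + (n - (a + 2 * b)) div 3 \<in> {i\<in>{..n}. b \<le> i \<and> 3 * i \<le> n + b}"
        "?c (n + b - 3 * (b + (n - (a + 2 * b)) div 3)) b (b + (n - (a + 2 * b)) div 3 - b) = ?c a b ((n - (a + 2 * b)) div 3)"
        by (simp_all add: j)
    qed
  qed
  also have "\<dots> = (\<Sum>b\<le>n. \<Sum>i\<le>n. if b \<le> i \<and> 3 * i \<le> n + b then ?c (n + b - 3 * i) b (i - b) else 0)"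
    by (simp only: sum.inter_filter finite_atMost)
  also have "\<dots> = (\<Sum>i\<le>n. \<Sum>b\<le>n. if b \<le> i \<and> 3 * i \<le> n + b then ?c (n + b - 3 * i) b (i - b) else 0)"
    by (rule sum.swap)
  also have "\<dots> = (\<Sum>i\<le>n. fps_nth (diagZ (int n - 3 * int i)) i)"
  proof (rule sum.cong[OF refl])
    fix i assume i: "i \<in> {..n}"
    have "(\<Sum>b\<le>n. if b \<le> i \<and> 3 * i \<le> n + b then ?c (n + b - 3 * i) b (i - b) else 0)
        = (\<Sum>b\<le>i. if b \<le> i \<and> 3 * i \<le> n + b then ?c (n + b - 3 * i) b (i - b) else 0)"
      by (rule sum.mono_neutral_right) (use i in auto)
    also have "\<dots> = fps_nth (diagZ (int n - 3 * int i)) i"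
      unfolding diagZ_def gsum_def fps_nth_Abs_fps
    proof (rule sum.cong[OF refl])
      fix b assume "b \<in> {..i}"
      moreover have "nat (int n - 3 * int i + int b) = n + b - 3 * i" by linarith
      ultimately show "(if b \<le> i \<and> 3 * i \<le> n + b then ?c (n + b - 3 * i) b (i - b) else 0) =
        fps_nth (if 0 \<le> int n - 3 * int i + int b
          then fps_X ^ b * (parts (nat (int n - 3 * int i + int b)) * parts b) else 0) i"
        by (auto simp: fps_X_power_mult_nth)
    qed
    finally show "(\<Sum>b\<le>n. if b \<le> i \<and> 3 * i \<le> n + b then ?c (n + b - 3 * i) b (i - b) else 0)
        = fps_nth (diagZ (int n - 3 * int i)) i" .
  qed
  finally show "fps_nth (interleave diagZ) n = fps_nth (euler_sum 1 * euler_sum 2) n" by (simp add: interleave_def)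
qed

section \<open>Truncated pentagonal sums\<close>

definition pentagonal_sum :: "nat \<Rightarrow> real fps" where
  "pentagonal_sum k = (\<Sum>n\<in>{- int k<..int k}. (-1) ^ nat \<bar>n\<bar> * fps_X ^ nat (n * (3 * n - 1) div 2))"

text \<open>Shanks' summand (-1)^s (q;q)_n/(q;q)_s q^(sn + s(s+1)/2), with the quotient written as a
  product.\<close>

definition shanks_term :: "nat \<Rightarrow> nat \<Rightarrow> real fps" where
  "shanks_term n s = (- 1) ^ s * (\<Prod>j\<in>{s..<n}. 1 - fps_X ^ Suc j) * fps_X ^ (s * n + (Suc s choose 2))"

lemma pentagonal_sum_Suc:
  "pentagonal_sum (Suc k) = pentagonal_sum k + (- 1) ^ k * fps_X ^ (k * (3 * k + 1) div 2)
     + (- 1) ^ Suc k * fps_X ^ (k * (3 * k + 1) div 2 + 2 * k + 1)"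
proof -
  have set: "{- int (Suc k)<..int (Suc k)} = insert (int (Suc k)) (insert (- int k) {- int k<..int k})"
    by auto
  have 1: "nat (- int k * (3 * (- int k) - 1) div 2) = k * (3 * k + 1) div 2"
  proof -
    have "- int k * (3 * (- int k) - 1) = int (k * (3 * k + 1))" by (simp add: algebra_simps)
    then have "- int k * (3 * (- int k) - 1) div 2 = int (k * (3 * k + 1) div 2)" by (simp only: zdiv_int of_nat_numeral)
    then show ?thesis by (simp only: nat_int)
  qed
  have 2: "nat (int (Suc k) * (3 * int (Suc k) - 1) div 2) = k * (3 * k + 1) div 2 + 2 * k + 1"
  proof -
    have "int (Suc k) * (3 * int (Suc k) - 1) = int (k * (3 * k + 1) + 2 * (2 * k + 1))" by (simp add: algebra_simps)
    then have "int (Suc k) * (3 * int (Suc k) - 1) div 2 = int ((k * (3 * k + 1) + 2 * (2 * k + 1)) div 2)"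
      by (simp only: zdiv_int of_nat_numeral)
    then have "nat (int (Suc k) * (3 * int (Suc k) - 1) div 2) = (k * (3 * k + 1) + 2 * (2 * k + 1)) div 2"
      by (simp only: nat_int)
    then show ?thesis by (simp only: div_mult_self2 zero_neq_numeral not_False_eq_True add.assoc)
  qed
  show ?thesis
    unfolding pentagonal_sum_def set
    by (subst sum.insert, simp, simp, subst sum.insert, simp, simp) (simp only: 1 2 abs_minus_cancel abs_of_nat nat_int, simp only: add_ac)
qed

text \<open>Raising \<open>n\<close> changes each term by two pieces (\<open>step\<close>). By
  \<open>shift\<close>, the first piece at \<open>s + 1\<close> cancels the second at
  \<open>s\<close>, so only the second piece at \<open>s = n\<close> survives.\<close>

lemma sum_shanks_term_Suc:
  "(\<Sum>s<Suc n. shanks_term (Suc n) s) = (\<Sum>s<Suc n. shanks_term n s) - shanks_term n n * fps_X ^ (2 * n + 1)"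
proof -
  have step: "shanks_term (Suc n) s - shanks_term n s = - (shanks_term n s * (1 - fps_X ^ s)) - shanks_term n s * fps_X ^ (n + s + 1)"
    if "s \<le> n" for s
  proof -
    have "(\<Prod>j\<in>{s..<Suc n}. 1 - fps_X ^ Suc j) = (\<Prod>j\<in>{s..<n}. 1 - fps_X ^ Suc j) * (1 - fps_X ^ Suc n :: real fps)"
      using that by simp
    then have "shanks_term (Suc n) s = shanks_term n s * ((1 - fps_X ^ Suc n) * fps_X ^ s)"
      unfolding shanks_term_def by (simp add: power_add mult_ac)
    then show ?thesis by (simp add: algebra_simps power_add)
  qed
  have shift: "shanks_term n (Suc s) * (1 - fps_X ^ Suc s) = - (shanks_term n s * fps_X ^ (n + s + 1))" if "s < n" for s
  proof -
    have "(\<Prod>j\<in>{s..<n}. 1 - fps_X ^ Suc j) = (1 - fps_X ^ Suc s) * (\<Prod>j\<in>{Suc s..<n}. 1 - fps_X ^ Suc j :: real fps)"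
      by (rule prod.atLeast_Suc_lessThan[OF that])
    then show ?thesis
      unfolding shanks_term_def Suc_choose_two[of "Suc s"] by (simp add: power_add mult_ac)
  qed
  have "(\<Sum>s<Suc n. shanks_term (Suc n) s) - (\<Sum>s<Suc n. shanks_term n s)
      = (\<Sum>s<Suc n. - (shanks_term n s * (1 - fps_X ^ s)) - shanks_term n s * fps_X ^ (n + s + 1))"
    unfolding sum_subtractf[symmetric] by (rule sum.cong[OF refl], rule step) simp
  also have "\<dots> = - (\<Sum>s<Suc n. shanks_term n s * (1 - fps_X ^ s)) - (\<Sum>s<Suc n. shanks_term n s * fps_X ^ (n + s + 1))"
    by (simp only: sum_subtractf sum_negf)
  also have "(\<Sum>s<Suc n. shanks_term n s * (1 - fps_X ^ s)) = (\<Sum>s<n. shanks_term n (Suc s) * (1 - fps_X ^ Suc s))"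
    unfolding sum.lessThan_Suc_shift by simp
  also have "\<dots> = - (\<Sum>s<n. shanks_term n s * fps_X ^ (n + s + 1))"
    unfolding sum_negf[symmetric] by (rule sum.cong[OF refl], rule shift) simp
  finally show ?thesis by (simp add: mult_2 mult_2_right algebra_simps)
qed

text \<open>The term \<open>shanks_term n n\<close> and the boundary term of
  \<open>sum_shanks_term_Suc\<close> are the two pentagonal powers added in passing to
  \<open>Suc n\<close>.\<close>

lemma pentagonal_sum_eq_shanks_term: "pentagonal_sum n = (\<Sum>s<n. shanks_term n s)"
proof (induction n)
  case (Suc n)
  have "n * n + (Suc n choose 2) = n * (3 * n + 1) div 2"
    unfolding pentagonal_eq using two_times_Suc_choose_two[of n] by (simp add: Suc_choose_two)
  then have "shanks_term n n = (- 1) ^ n * fps_X ^ (n * (3 * n + 1) div 2)"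
    by (simp add: shanks_term_def)
  then show ?case
    unfolding pentagonal_sum_Suc sum_shanks_term_Suc Suc.IH sum.lessThan_Suc[of "shanks_term n"]
    by (simp add: power_add mult_ac)
qed (simp add: pentagonal_sum_def)

text \<open>Shanks terms with \<open>s > 0\<close> have order above \<open>n\<close>, so in low
  degrees only \<open>s = 0\<close> remains, which is the partial product of (q;q)_inf.\<close>

lemma pentagonal_sum_LIMSEQ: "pentagonal_sum \<longlonglongrightarrow> qpochhammer_inf fps_X fps_X"
proof (rule tendsto_fpsI)
  fix i
  have "(\<lambda>n. \<Prod>j<n. 1 - fps_X * fps_X ^ j) \<longlonglongrightarrow> qpochhammer_inf fps_X (fps_X :: real fps)"
    by (rule qpochhammer_inf_fps_LIMSEQ_lessThan) simp_all
  then have "\<forall>\<^sub>F n in sequentially. fps_nth (\<Prod>j<n. 1 - fps_X * fps_X ^ j :: real fps) i = fps_nth (qpochhammer_inf fps_X fps_X) i"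
    by (simp add: tendsto_fps_iff)
  then show "\<forall>\<^sub>F n in sequentially. fps_nth (pentagonal_sum n) i = fps_nth (qpochhammer_inf fps_X fps_X) i"
    using eventually_gt_at_top[of i]
  proof eventually_elim
    case (elim n)
    then obtain m where m: "n = Suc m" by (cases n) auto
    have "fps_nth (shanks_term n (Suc s)) i = 0" for s
    proof -
      have "i < Suc s * n + (Suc (Suc s) choose 2)" using elim(2) by (simp add: trans_less_add1)
      then show ?thesis
        unfolding shanks_term_def mult.commute[of _ "fps_X ^ _"] by (rule fps_X_power_mult_vanish)
    qed
    then have "fps_nth (pentagonal_sum n) i = fps_nth (shanks_term n 0) i"
      unfolding pentagonal_sum_eq_shanks_term m sum.lessThan_Suc_shift by (simp add: fps_sum_nth)
    also have "shanks_term n 0 = (\<Prod>j<n. 1 - fps_X * fps_X ^ j)"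
      by (simp add: shanks_term_def atLeast0LessThan numeral_2_eq_2)
    finally show ?case using elim(1) by simp
  qed
qed

section \<open>Identification of the two solutions and conclusion\<close>

lemma interleave_gapZ_eq:
  assumes "0 < k"
  shows "interleave (gapZ k) = (- 1) ^ (k - 1) * (pentagonal_sum k - qpochhammer_inf fps_X fps_X) * interleave diagZ"
proof -
  \<comment> \<open>The discrepancy of the two sides, indexed from \<open>Suc k\<close>. Both
    satisfy the same recurrence, so \<open>y\<close> only changes sign with \<open>k\<close>; being
    eventually zero in each degree, it is zero.\<close>
  define y where "y = (\<lambda>k. interleave (gapZ (Suc k)) - (- 1) ^ k * (pentagonal_sum (Suc k) - qpochhammer_inf fps_X fps_X) * interleave diagZ)"
  have "y (Suc k) = - y k" for k
  proof -
    have "interleave (gapZ (Suc k)) + interleave (gapZ (Suc (Suc k))) = (- 1) ^ k * (pentagonal_sum (Suc k) - pentagonal_sum (Suc (Suc k))) * interleave diagZ"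
      unfolding interleave_gapZ_rec[OF zero_less_Suc] pentagonal_sum_Suc[of "Suc k"] by (simp add: algebra_simps)
    then show ?thesis by (simp add: y_def algebra_simps eq_neg_iff_add_eq_0)
  qed
  then have "y (k + m) = (- 1) ^ m * y k" for k m
    by (induction m) simp_all
  then have abs: "\<bar>fps_nth (y (k + m)) n\<bar> = \<bar>fps_nth (y k) n\<bar>" for k m n
    by (simp add: minus_one_power_mult_nth abs_mult)
  have "fps_nth (y k) n = 0" for k n
  proof -
    have "(\<lambda>n. (pentagonal_sum n - qpochhammer_inf fps_X fps_X) * interleave diagZ) \<longlonglongrightarrow> 0 * interleave diagZ"
      by (intro tendsto_mult_fps tendsto_const tendsto_fpsI)
        (use pentagonal_sum_LIMSEQ in \<open>simp add: tendsto_fps_iff\<close>)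
    then have "\<forall>\<^sub>F m in sequentially. fps_nth ((pentagonal_sum m - qpochhammer_inf fps_X fps_X) * interleave diagZ) n = 0"
      by (simp add: tendsto_fps_iff)
    then obtain M where M: "\<And>m. M \<le> m \<Longrightarrow> fps_nth ((pentagonal_sum m - qpochhammer_inf fps_X fps_X) * interleave diagZ) n = 0"
      by (auto simp: eventually_sequentially)
    \<comment> \<open>The index exceeds both \<open>M\<close>, for the pentagonal side, and
      \<open>n\<close>, so that \<open>interleave_gapZ_vanish\<close> covers degree
      \<open>n\<close>.\<close>
    have "n < Suc (k + (M + n)) * (3 * Suc (k + (M + n)) + 1) div 2"
      unfolding pentagonal_eq by simp
    then have "fps_nth (y (k + (M + n))) n = 0"
      using M[of "Suc (k + (M + n))"] by (simp add: y_def mult.assoc minus_one_power_mult_nth interleave_gapZ_vanish)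
    then show ?thesis using abs[of k "M + n" n] by simp
  qed
  then have "y (k - 1) = 0" by (simp add: fps_eq_iff)
  then show ?thesis using assms by (simp add: y_def)
qed

theorem corollary2p8:
  fixes k :: nat
  assumes "k \<ge> 1"
  shows "let q = (fps_X :: real fps);
             F = (-1) ^ (k - 1) *
                 (inverse (qpochhammer_inf q q) *
                    (\<Sum>n\<in>{- int k<..int k}. (-1) ^ nat \<bar>n\<bar> * q ^ nat (n * (3 * n - 1) div 2)) - 1) *
                 qpochhammer_inf_list [q ^ 3, q ^ 9] (q ^ 12)
         in (\<forall>n < k * (3 * k + 1) div 2. fps_nth F n = 0) \<and>
            (\<forall>n \<ge> k * (3 * k + 1) div 2. fps_nth F n > 0)"
proof -
  have k: "0 < k" using assms by simp
  let ?P = "\<lambda>a m. qpochhammer_inf (fps_X ^ a) (fps_X ^ m) :: real fps"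
  define E where "E = qpochhammer_inf fps_X (fps_X :: real fps)"
  define W where "W = qpochhammer_inf_list [fps_X ^ 3, fps_X ^ 9] (fps_X ^ 12 :: real fps)"
  define G where "G = interleave diagZ"
  define F where "F = (- 1) ^ (k - 1) * (inverse E * pentagonal_sum k - 1) * W"
  have E0: "fps_nth E 0 = 1" unfolding E_def by (rule qpochhammer_inf_nth_0) simp_all
  have Z0: "fps_nth (?P 6 6) 0 = 1" by (rule qpochhammer_inf_nth_0) simp_all
  have E: "E = ?P 1 3 * ?P 2 3 * ?P 3 3"
    unfolding E_def using qpochhammer_inf_split[of fps_X fps_X 3]
    by (simp add: numeral_3_eq_3 lessThan_Suc mult_ac power2_eq_square)
  \<comment> \<open>Splitting modulo 4 here and modulo 2 below gives (q^3,q^9;q^12) =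
    (q^3;q^3)/(q^6;q^6).\<close>
  have "?P 3 3 = ?P 3 12 * ?P 6 12 * ?P 9 12 * ?P 12 12"
    using qpochhammer_inf_split[of "fps_X ^ 3" "fps_X ^ 3" 4]
    by (simp add: lessThan_Suc lessThan_nat_numeral mult_ac flip: power_add power_mult)
  moreover have "?P 6 6 = ?P 6 12 * ?P 12 12"
    using qpochhammer_inf_split[of "fps_X ^ 6" "fps_X ^ 6" 2]
    by (simp add: lessThan_Suc lessThan_nat_numeral mult_ac flip: power_add power_mult)
  ultimately have W: "?P 3 3 = W * ?P 6 6"
    by (simp add: W_def qpochhammer_inf_list_def mult_ac)
  have G: "G * (?P 1 3 * ?P 2 3) = 1"
  proof -
    have "G * (?P 1 3 * ?P 2 3) = (?P 1 3 * euler_sum 1) * (?P 2 3 * euler_sum 2)"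
      unfolding G_def interleave_diagZ by (simp only: mult_ac)
    then show ?thesis by (simp only: qpochhammer_inf_mult_euler_sum zero_less_one zero_less_numeral mult_1_right)
  qed
  have EE: "E * inverse E = 1" "?P 6 6 * inverse (?P 6 6) = 1"
    by (simp_all add: inverse_mult_eq_1' E0 Z0)
  \<comment> \<open>Two factors equal to 1 are inserted so that a full copy of \<open>E\<close>
    forms and cancels \<open>inverse E\<close>.\<close>
  have "inverse E * W = inverse E * W * (G * (?P 1 3 * ?P 2 3)) * (?P 6 6 * inverse (?P 6 6))"
    by (simp only: G EE mult_1_right)
  also have "\<dots> = (E * inverse E) * (G * inverse (?P 6 6))"
    unfolding E W by (simp only: mult_ac)
  finally have "inverse E * W = G * inverse (?P 6 6)" by (simp only: EE mult_1_left)
  moreover have "F = (- 1) ^ (k - 1) * (pentagonal_sum k - E) * (inverse E * W)"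
  proof -
    have "inverse E * pentagonal_sum k - 1 = (pentagonal_sum k - E) * inverse E"
      unfolding left_diff_distrib EE by (simp only: mult.commute)
    then show ?thesis unfolding F_def by (simp only: mult_ac)
  qed
  ultimately have F: "F = interleave (gapZ k) * inverse (?P 6 6)"
    unfolding interleave_gapZ_eq[OF k] E_def G_def by (simp only: mult.assoc)
  have "fps_nth F n = 0" if "n < k * (3 * k + 1) div 2" for n
    unfolding F fps_mult_nth using that by (intro sum.neutral ballI) (simp add: interleave_gapZ_vanish[OF k])
  \<comment> \<open>Coefficient \<open>n\<close> of the interleaved series meets the constant term 1
    of the inverse product; all other contributions are nonnegative.\<close>
  moreover have "0 < fps_nth F n" if "k * (3 * k + 1) div 2 \<le> n" for n
    unfolding F using that
    by (intro nonneg_fps_mult_pos1 nonneg_fps_interleave_gapZ interleave_gapZ_pos nonneg_fps_inverse_qpochhammer_inf k)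
      (simp_all add: Z0)
  ultimately show ?thesis
    unfolding Let_def F_def E_def W_def pentagonal_sum_def by blast
qed

end
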